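(* Let $(X_k)_{k\in\mathbb{Z}}$ be an $L_2$-stationary sequence of square-integrable real random variables with $E(X_k)=0$, $E(X_k^2)=1$, and such that $X_k$ has the same distribution as $X_0$ for all $k\in\mathbb{Z}$. Let $\rho=\mathrm{corr}(X_0,X_1)$ and $r_2=\mathrm{corr}(X_0,X_2)$, and assume $\rho\ne0$ and $r_2+1-2|\rho|>0$. Suppose there are real constants $a,b,A,B,C$ such that for all $k\in\mathbb{Z}$ $$E(X_k\mid \dots,X_{k-2},X_{k-1},X_{k+1},X_{k+2},\dots)=a(X_{k-1}+X_{k+1})+b,$$ $$E(X_k^2\mid \dots,X_{k-2},X_{k-1},X_{k+1},X_{k+2},\dots)=A(X_{k-1}^2+X_{k+1}^2)+BX_{k-1}X_{k+1}+C,$$ and that $$A\left(\rho^2+\frac{1}{\rho^2}\right)+B=1 .$$ Put $R=B\left(\rho+\frac1\rho\right)^2$. Then: (i) If $0\le R<2$, then the distribution of $X_0$ is uniquely determined (by $\rho$ and $R$), symmetric, and supported on a finite interval. When $R=0$, $X_0$ takes two values $\pm c$. (ii) If $R=2$, then the distribution of $X_0$ is normal. (iii) If $R>2$, then the distribution of $X_0$ is not determined by its moments.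
   Context: $L_2$-stationary means that the variables are square-integrable, $E(X_k)$ does not depend on $k$, and $E(X_kX_{k+j})$ does not depend on $k$ for each $j$. The conditional expectations are given the $\sigma$-field generated by $\{X_j: j\ne k\}$, with equalities almost surely. "Uniquely determined by $\rho$ and $R$" means that any two sequences satisfying all the hypotheses with the same values of $\rho$ and $R$ have the same one-dimensional distribution. A distribution is not determined by its moments if there is a different probability measure on $\mathbb{R}$ with the same moments of all orders. *)

theory Defs
  imports "HOL-Probability.Probability"
begin

definition correlation :: "'a measure \<Rightarrow> ('a \<Rightarrow> real) \<Rightarrow> ('a \<Rightarrow> real) \<Rightarrow> real" where
  "correlation M X Y =
     (\<integral>\<omega>. (X \<omega> - (\<integral>\<omega>. X \<omega> \<partial>M)) * (Y \<omega> - (\<integral>\<omega>. Y \<omega> \<partial>M)) \<partial>M) /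
     sqrt ((\<integral>\<omega>. (X \<omega> - (\<integral>\<omega>. X \<omega> \<partial>M))\<^sup>2 \<partial>M) * (\<integral>\<omega>. (Y \<omega> - (\<integral>\<omega>. Y \<omega> \<partial>M))\<^sup>2 \<partial>M))"

definition L2_stationary :: "'a measure \<Rightarrow> (int \<Rightarrow> 'a \<Rightarrow> real) \<Rightarrow> bool" where
  "L2_stationary M X \<longleftrightarrow>
     (\<forall>k. X k \<in> borel_measurable M) \<and>
     (\<forall>k. integrable M (\<lambda>\<omega>. (X k \<omega>)\<^sup>2)) \<and>
     (\<forall>k l. (\<integral>\<omega>. X k \<omega> \<partial>M) = (\<integral>\<omega>. X l \<omega> \<partial>M)) \<and>
     (\<forall>j k l. (\<integral>\<omega>. X k \<omega> * X (k + j) \<omega> \<partial>M) = (\<integral>\<omega>. X l \<omega> * X (l + j) \<omega> \<partial>M))"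

definition sigma_others :: "'a measure \<Rightarrow> (int \<Rightarrow> 'a \<Rightarrow> real) \<Rightarrow> int \<Rightarrow> 'a measure" where
  "sigma_others M X k =
     sigma (space M) {X j -` S \<inter> space M | j S. j \<noteq> k \<and> S \<in> sets borel}"

locale quadratic_regression_sequence = prob_space M
  for M :: "'a measure" +
  fixes X :: "int \<Rightarrow> 'a \<Rightarrow> real" and a b A B C :: real
  assumes stationary: "L2_stationary M X"
    and mean_zero: "\<And>k. (\<integral>\<omega>. X k \<omega> \<partial>M) = 0"
    and second_moment_one: "\<And>k. (\<integral>\<omega>. (X k \<omega>)\<^sup>2 \<partial>M) = 1"
    and same_distribution: "\<And>k. distr M borel (X k) = distr M borel (X 0)"
    and corr_1_nonzero: "correlation M (X 0) (X 1) \<noteq> 0"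
    and corr_2_bound: "correlation M (X 0) (X 2) + 1 - 2 * \<bar>correlation M (X 0) (X 1)\<bar> > 0"
    and linear_regression:
      "\<And>k. AE \<omega> in M. real_cond_exp M (sigma_others M X k) (X k) \<omega> =
         a * (X (k - 1) \<omega> + X (k + 1) \<omega>) + b"
    and quadratic_regression:
      "\<And>k. AE \<omega> in M. real_cond_exp M (sigma_others M X k) (\<lambda>\<omega>. (X k \<omega>)\<^sup>2) \<omega> =
         A * ((X (k - 1) \<omega>)\<^sup>2 + (X (k + 1) \<omega>)\<^sup>2) + B * X (k - 1) \<omega> * X (k + 1) \<omega> + C"
    and coefficients:
      "A * ((correlation M (X 0) (X 1))\<^sup>2 + 1 / (correlation M (X 0) (X 1))\<^sup>2) + B = 1"

definition regression_ratio :: "'a measure \<Rightarrow> (int \<Rightarrow> 'a \<Rightarrow> real) \<Rightarrow> real \<Rightarrow> real" where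
  "regression_ratio M X B =
     B * (correlation M (X 0) (X 1) + 1 / correlation M (X 0) (X 1))\<^sup>2"

text \<open>All moments of the law must exist; the competing law must have the same (finite) moments.\<close>

definition moment_indeterminate :: "real measure \<Rightarrow> bool" where
  "moment_indeterminate \<mu> \<longleftrightarrow>
     (\<forall>n::nat. integrable \<mu> (\<lambda>x. x ^ n)) \<and>
     (\<exists>\<nu>. prob_space \<nu> \<and> sets \<nu> = sets borel \<and> \<nu> \<noteq> \<mu> \<and>
        (\<forall>n::nat. integrable \<nu> (\<lambda>x. x ^ n) \<and> (\<integral>x. x ^ n \<partial>\<nu>) = (\<integral>x. x ^ n \<partial>\<mu>)))"

end

theory Submission
  imports Defs
begin

text \<open>
  The proof identifies the moments of \<open>X 0\<close> as those of a \<open>q\<close>-Gaussian law, where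
  \<open>q = (R - (1 - \<rho>\<^sup>4)) / (R * \<rho>\<^sup>4 + (1 - \<rho>\<^sup>4))\<close>. This \<open>q\<close> is \<open>- 1\<close> at \<open>R = 0\<close>,
  lies in \<open>[- 1, 1)\<close> for \<open>0 \<le> R < 2\<close>, equals \<open>1\<close> at \<open>R = 2\<close> and exceeds \<open>1\<close> for \<open>R > 2\<close>.

  The linear regression makes the correlations a bounded solution of a second-order recurrence,
  hence equal to \<open>\<rho> ^ |j|\<close> with \<open>|\<rho>| < 1\<close>. The same recurrence shows that the best prediction
  of \<open>X (k + 1)\<close> from the past is \<open>\<rho> * X k\<close> (\<open>linear_prediction\<close>), and together with the quadratic
  regression that the conditional variance is constant (\<open>conditional_variance\<close>). Applied in both
  time directions, Chebyshev's inequality then yields a bound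
  \<open>P(|X 0| \<ge> s) \<le> D / s\<^sup>2 * P(|X 0| \<ge> \<theta> s)\<close> (\<open>tail_decay\<close>), so all moments are finite.

  Let \<open>H n\<close> be the \<open>q\<close>-Hermite polynomials, \<open>x * H n = H (n + 1) + [n] * H (n - 1)\<close> with
  \<open>[n] = 1 + q + \<dots> + q ^ (n - 1)\<close>. An induction on \<open>n\<close> shows that prediction from the past multiplies
  \<open>H n\<close> by \<open>\<rho> ^ n\<close> (\<open>hermite_prediction\<close>): mixed moments of \<open>X (k + 1)\<close> and its square with
  polynomials in \<open>X (k + 2)\<close> can be computed both by prediction and by the regression of
  \<open>X (k + 1)\<close> on its neighbours. As \<open>X 0\<close> and \<open>X 1\<close> have the same law, \<open>H n (X 0)\<close> has mean \<open>0\<close>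
  for \<open>n > 0\<close>, and these equations determine all moments.

  For \<open>- 1 \<le> q < 1\<close> the numbers \<open>[n]\<close> are bounded, so the moments grow geometrically; the law is
  then bounded and determined by its moments, and it is symmetric because the odd moments vanish.
  At \<open>q = - 1\<close> the fourth moment equals the squared second moment, which leaves two values. At
  \<open>q = 1\<close> the moments are those of the standard normal law, which is also determined by them. For
  \<open>q > 1\<close> two explicit laws with the same moments and disjoint supports are constructed
  (\<open>q_moments_indeterminate\<close>), and at least one of them differs from the law of \<open>X 0\<close>.
\<close>

section \<open>Continuous q-Hermite polynomials and their moment functional\<close>

text \<open>
  The recurrence below gives the \<open>q\<close>-Hermite polynomials in the normalization in which \<open>q = 1\<close>
  yields the Hermite polynomials of the standard normal law.
\<close>

definition q_number :: "real \<Rightarrow> nat \<Rightarrow> real" where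
  "q_number q n = (\<Sum>i<n. q ^ i)"

lemma q_number_0 [simp]: "q_number q 0 = 0"
  by (simp add: q_number_def)

lemma q_number_Suc: "q_number q (Suc n) = q * q_number q n + 1"
  unfolding q_number_def by (subst sum.lessThan_Suc_shift) (simp add: sum_distrib_left)

lemma q_number_1 [simp]: "q_number 1 n = real n"
  by (simp add: q_number_def)

lemma abs_q_number_le:
  assumes "-1 \<le> q" "q < 1"
  shows "\<bar>q_number q n\<bar> \<le> 2 / (1 - q)"
proof -
  have "q_number q n = (1 - q ^ n) / (1 - q)"
    using assms by (simp add: q_number_def sum_gp_strict)
  moreover have "\<bar>q ^ n\<bar> \<le> 1"
    using assms by (simp add: power_abs power_le_one)
  ultimately show ?thesis
    using assms by (simp add: divide_right_mono abs_le_iff)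
qed

fun q_hermite :: "real \<Rightarrow> nat \<Rightarrow> real \<Rightarrow> real" where
  "q_hermite q 0 x = 1"
| "q_hermite q (Suc 0) x = x"
| "q_hermite q (Suc (Suc n)) x =
     x * q_hermite q (Suc n) x - q_number q (Suc n) * q_hermite q n x"

lemma times_q_hermite:
  "x * q_hermite q n x = q_hermite q (Suc n) x + q_number q n * q_hermite q (n - 1) x"
  by (cases n) auto

text \<open>
  The factor \<open>q_number q n\<close> vanishes at \<open>n = 0\<close>, exactly where truncated subtraction would make
  the recurrence wrong.
\<close>

lemma q_number_mult_q_hermite_pred:
  "q_number q n * (x * q_hermite q (n - 1) x) =
     q_number q n * (q_hermite q n x + q_number q (n - 1) * q_hermite q (n - 2) x)"
  by (cases n) (auto simp: times_q_hermite numeral_2_eq_2)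

lemma borel_measurable_q_hermite [measurable]: "q_hermite q n \<in> borel_measurable borel"
proof (induction n rule: induct_nat_012)
  case 0
  then show ?case by (simp cong: measurable_cong)
next
  case 1
  then show ?case by (simp cong: measurable_cong)
next
  case (ge2 n)
  then show ?case
    by (subst measurable_cong[OF q_hermite.simps(3)])
      (intro borel_measurable_diff borel_measurable_times borel_measurable_const; simp)
qed

text \<open>
  A functional that annihilates every \<open>q_hermite q k\<close> with \<open>k > 0\<close> is fixed by the three-term
  recurrence: \<open>q_moment q n k\<close> is its value at the function \<open>x ^ n * q_hermite q k x\<close>.
\<close>

fun q_moment :: "real \<Rightarrow> nat \<Rightarrow> nat \<Rightarrow> real" where
  "q_moment q 0 k = (if k = 0 then 1 else 0)"
| "q_moment q (Suc n) k = q_moment q n (Suc k) + q_number q k * q_moment q n (k - 1)"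

text \<open>Each recurrence step changes \<open>k\<close> by one, and only \<open>k = 0\<close> contributes at the end.\<close>

lemma q_moment_odd: "odd (n + k) \<Longrightarrow> q_moment q n k = 0"
proof (induction n arbitrary: k)
  case (Suc n)
  then show ?case by (cases k) auto
qed (auto simp: odd_pos)

lemma abs_q_moment_le:
  assumes "\<And>k. \<bar>q_number q k\<bar> \<le> D"
  shows "\<bar>q_moment q n k\<bar> \<le> (1 + D) ^ n"
proof (induction n arbitrary: k)
  case (Suc n)
  have "D \<ge> 0" using assms[of 0] by simp
  have "\<bar>q_number q k * q_moment q n (k - 1)\<bar> \<le> D * (1 + D) ^ n"
    unfolding abs_mult using Suc assms \<open>D \<ge> 0\<close> by (intro mult_mono) auto
  then show ?case using Suc[of "Suc k"] by (simp add: algebra_simps)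
qed simp

lemma integrable_power_times_q_hermite:
  fixes Y :: "'a \<Rightarrow> real"
  assumes "\<And>n. integrable M (\<lambda>\<omega>. Y \<omega> ^ n)"
  shows "integrable M (\<lambda>\<omega>. Y \<omega> ^ n * q_hermite q k (Y \<omega>))"
proof (induction k arbitrary: n rule: induct_nat_012)
  case 0
  then show ?case using assms by simp
next
  case 1
  then show ?case using assms[of "Suc n"] by (simp add: mult.commute)
next
  case (ge2 k)
  have "(\<lambda>\<omega>. Y \<omega> ^ n * q_hermite q (Suc (Suc k)) (Y \<omega>)) =
     (\<lambda>\<omega>. Y \<omega> ^ Suc n * q_hermite q (Suc k) (Y \<omega>) - q_number q (Suc k) * (Y \<omega> ^ n * q_hermite q k (Y \<omega>)))"
    by (auto simp: algebra_simps)
  then show ?case using ge2(1)[of n] ge2(2)[of "Suc n"]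
    by (simp only:) (intro Bochner_Integration.integrable_diff integrable_mult_right)
qed

lemma (in prob_space) expectation_power_eq_q_moment:
  fixes Y :: "'a \<Rightarrow> real"
  assumes int: "\<And>n. integrable M (\<lambda>\<omega>. Y \<omega> ^ n)"
    and ann: "\<And>k. k > 0 \<Longrightarrow> expectation (\<lambda>\<omega>. q_hermite q k (Y \<omega>)) = 0"
  shows "expectation (\<lambda>\<omega>. Y \<omega> ^ n) = q_moment q n 0"
proof -
  have "expectation (\<lambda>\<omega>. Y \<omega> ^ n * q_hermite q k (Y \<omega>)) = q_moment q n k" for k
  proof (induction n arbitrary: k)
    case 0
    then show ?case using ann by (auto simp: prob_space)
  next
    case (Suc n)
    have "Y \<omega> ^ Suc n * q_hermite q k (Y \<omega>) = Y \<omega> ^ n * q_hermite q (Suc k) (Y \<omega>)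
        + q_number q k * (Y \<omega> ^ n * q_hermite q (k - 1) (Y \<omega>))" for \<omega>
      using times_q_hermite[of "Y \<omega>" q k] by (simp add: algebra_simps) (metis distrib_left mult.left_commute)
    then have "expectation (\<lambda>\<omega>. Y \<omega> ^ Suc n * q_hermite q k (Y \<omega>)) =
       expectation (\<lambda>\<omega>. Y \<omega> ^ n * q_hermite q (Suc k) (Y \<omega>)
        + q_number q k * (Y \<omega> ^ n * q_hermite q (k - 1) (Y \<omega>)))"
      by presburger
    also have "\<dots> = q_moment q (Suc n) k"
      using integrable_power_times_q_hermite[OF int] Suc
      by (subst Bochner_Integration.integral_add) auto
    finally show ?case .
  qed
  from this[of 0] show ?thesis by simp
qed

section \<open>Determinacy of moments\<close>

text \<open>
  Taylor's formula bounds the distance between a characteristic function and its Taylor polynomial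
  by an absolute moment. When these bounds tend to \<open>0\<close> at every argument, the
  moments determine the characteristic function and hence, by Levy's theorem, the law.
\<close>

lemma moments_determine_distribution:
  assumes "real_distribution \<mu>" "real_distribution \<nu>"
    and int: "\<And>n. integrable \<mu> (\<lambda>x. x ^ n)" "\<And>n. integrable \<nu> (\<lambda>x. x ^ n)"
    and eq: "\<And>n. (\<integral>x. x ^ n \<partial>\<mu>) = m n" "\<And>n. (\<integral>x. x ^ n \<partial>\<nu>) = m n"
    and lim: "\<And>t. (\<lambda>n. t ^ (2 * n) / fact (2 * n) * m (2 * n)) \<longlonglongrightarrow> 0"
  shows "\<mu> = \<nu>"
proof (rule Levy_uniqueness)
  show "char \<mu> = char \<nu>"
  proof
    fix t :: real
    define T where "T n = (\<Sum>k \<le> 2 * n. ((\<i> * t) ^ k / fact k) * m k)" for n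
    have bound: "cmod (char \<kappa> t - T n) \<le> 2 * (t ^ (2 * n) / fact (2 * n) * m (2 * n))"
      if "real_distribution \<kappa>" "\<And>n. integrable \<kappa> (\<lambda>x. x ^ n)" "\<And>n. (\<integral>x. x ^ n \<partial>\<kappa>) = m n" for \<kappa> n
      using real_distribution.char_approx1[OF that(1), of "2 * n" t] that(2,3)
      by (simp add: T_def power_abs[symmetric])
    have conv: "T \<longlonglongrightarrow> char \<kappa> t"
      if "real_distribution \<kappa>" "\<And>n. integrable \<kappa> (\<lambda>x. x ^ n)" "\<And>n. (\<integral>x. x ^ n \<partial>\<kappa>) = m n" for \<kappa>
    proof (rule LIM_zero_cancel, rule Lim_null_comparison)
      show "\<forall>\<^sub>F n in sequentially. cmod (T n - char \<kappa> t) \<le> 2 * (t ^ (2 * n) / fact (2 * n) * m (2 * n))"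
        using bound[OF that] by (simp add: norm_minus_commute)
      show "(\<lambda>n. 2 * (t ^ (2 * n) / fact (2 * n) * m (2 * n))) \<longlonglongrightarrow> 0"
        using tendsto_mult_left[OF lim[of t], of 2] by simp
    qed
    show "char \<mu> t = char \<nu> t"
      using LIMSEQ_unique conv assms by blast
  qed
qed (use assms in auto)


lemma power_over_fact_tendsto_0: "(\<lambda>n. x ^ n / fact n) \<longlonglongrightarrow> (0::real)"
  using summable_LIMSEQ_zero[OF summable_exp[of x]] by (simp add: field_simps)

text \<open>
  The growth condition of \<open>moments_determine_distribution\<close> is met by geometric moments, treated
  here, and by the moments of the normal law, treated in \<open>normal_moments_taylor\<close>.
\<close>

lemma geometric_moments_taylor:
  fixes t :: real
  assumes "\<And>n. \<bar>m n\<bar> \<le> K ^ n"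
  shows "(\<lambda>n. t ^ (2 * n) / fact (2 * n) * m (2 * n)) \<longlonglongrightarrow> 0"
proof (rule Lim_null_comparison)
  have "(\<lambda>n. (\<bar>t\<bar> * K) ^ n / fact n) \<longlonglongrightarrow> 0"
    by (rule power_over_fact_tendsto_0)
  then show "(\<lambda>n. (\<bar>t\<bar> * K) ^ (2 * n) / fact (2 * n)) \<longlonglongrightarrow> 0"
    by (rule LIMSEQ_subseq_LIMSEQ[unfolded comp_def]) (simp add: strict_mono_def)
  show "\<forall>\<^sub>F n in sequentially.
      norm (t ^ (2 * n) / fact (2 * n) * m (2 * n)) \<le> (\<bar>t\<bar> * K) ^ (2 * n) / fact (2 * n)"
    using assms by (auto simp: abs_mult power_mult_distrib divide_right_mono mult_left_mono power_abs)
qed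

lemma q_moment_eq_0: "n < k \<Longrightarrow> q_moment q n k = 0"
  by (induction n arbitrary: k) auto

text \<open>
  For \<open>k = 0\<close> these are the even moments of the standard normal law; general \<open>k\<close> is what the
  recurrence needs.
\<close>

lemma q_moment_1: "q_moment 1 (k + 2 * j) k = fact (k + 2 * j) / (2 ^ j * fact j)"
proof (induction "k + 2 * j" arbitrary: k j)
  case 0
  then show ?case by simp
next
  case (Suc n)
  have low: "real k * q_moment 1 n (k - 1) = real k * (fact n / (2 ^ j * fact j))"
  proof (cases k)
    case (Suc k')
    then show ?thesis using Suc.hyps(1)[of k' j] Suc.hyps(2) by simp
  qed simp
  have high: "q_moment 1 n (Suc k) = 2 * real j * (fact n / (2 ^ j * fact j))"
  proof (cases j)
    case 0
    then show ?thesis using Suc.hyps(2) by (simp add: q_moment_eq_0)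
  next
    case (Suc i)
    then have "n = Suc k + 2 * i" using Suc.hyps(2) by simp
    then have "q_moment 1 n (Suc k) = fact n / (2 ^ i * fact i)"
      using Suc.hyps(1)[of "Suc k" i] by simp
    then show ?thesis using Suc by (simp add: field_simps del: of_nat_Suc)
  qed
  have "q_moment 1 (Suc n) k = (2 * real j + real k) * (fact n / (2 ^ j * fact j))"
    using low high by (simp add: distrib_right add_divide_distrib)
  also have "2 * real j + real k = real (Suc n)" using Suc.hyps(2) by simp
  finally show ?case using Suc.hyps(2)[symmetric] by simp
qed

lemma std_normal_expectation_power:
  "(\<integral>x. x ^ n \<partial>std_normal_distribution) = q_moment 1 n 0"
proof (cases "even n")
  case True
  then obtain j where "n = 2 * j" by blast
  then show ?thesis using q_moment_1[of 0 j] integral_std_normal_moment_even[of j]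
    by (simp add: integral_density)
next
  case False
  then obtain j where "n = 2 * j + 1" by (blast elim: oddE)
  then show ?thesis using q_moment_odd[of n 0 1] integral_std_normal_moment_odd[of j]
    by (simp add: integral_density)
qed

lemma normal_moments_taylor:
  "(\<lambda>n. t ^ (2 * n) / fact (2 * n) * q_moment 1 (2 * n) 0) \<longlonglongrightarrow> 0"
proof -
  have "(\<lambda>n. (t\<^sup>2 / 2) ^ n / fact n) \<longlonglongrightarrow> 0"
    by (rule power_over_fact_tendsto_0)
  moreover have "q_moment 1 (2 * n) 0 = fact (2 * n) / (2 ^ n * fact n)" for n
    using q_moment_1[of 0 n] by simp
  ultimately show ?thesis
    by (simp add: power_mult power_divide)
qed

text \<open>
  If \<open>|Y| \<ge> t\<close> had positive probability \<open>p\<close> for some \<open>t > K\<close>, the even moments of \<open>Y\<close> would be at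
  least \<open>p * t ^ (2 * n)\<close>, which outgrows \<open>K ^ (2 * n)\<close>.
\<close>

lemma (in prob_space) geometric_moments_imp_bounded:
  fixes Y :: "'a \<Rightarrow> real"
  assumes [measurable]: "random_variable borel Y"
    and int: "\<And>n. integrable M (\<lambda>\<omega>. Y \<omega> ^ n)"
    and bound: "\<And>n. expectation (\<lambda>\<omega>. Y \<omega> ^ n) \<le> K ^ n" and K: "K > 0"
  shows "AE \<omega> in M. Y \<omega> \<in> {- K - 1..K + 1}"
proof -
  define p where "p = prob {\<omega> \<in> space M. K + 1 \<le> \<bar>Y \<omega>\<bar>}"
  have "p * ((K + 1) / K) ^ (2 * n) \<le> 1" for n
  proof -
    have "(K + 1) ^ (2 * n) * p = expectation (\<lambda>\<omega>. (K + 1) ^ (2 * n) * indicator {\<omega> \<in> space M. K + 1 \<le> \<bar>Y \<omega>\<bar>} \<omega>)"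
      by (simp add: p_def)
    also have "\<dots> \<le> expectation (\<lambda>\<omega>. Y \<omega> ^ (2 * n))"
    proof (rule integral_mono)
      show "integrable M (\<lambda>\<omega>. (K + 1) ^ (2 * n) * indicator {\<omega> \<in> space M. K + 1 \<le> \<bar>Y \<omega>\<bar>} \<omega>)"
        by (intro integrable_mult_right integrable_real_indicator) (auto simp: emeasure_eq_measure)
      fix \<omega>
      show "(K + 1) ^ (2 * n) * indicator {\<omega> \<in> space M. K + 1 \<le> \<bar>Y \<omega>\<bar>} \<omega> \<le> Y \<omega> ^ (2 * n)"
        using power_mono[of "K + 1" "\<bar>Y \<omega>\<bar>" "2 * n"] K by (auto simp: indicator_def power_even_abs)
    qed (use int in auto)
    also have "\<dots> \<le> K ^ (2 * n)" by (rule bound)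
    finally show ?thesis using K by (simp add: power_divide divide_le_eq mult.commute)
  qed
  moreover have "p > 0 \<Longrightarrow> \<exists>n. 1 / p < ((K + 1) / K) ^ n"
    by (rule real_arch_pow) (use K in simp)
  moreover have "((K + 1) / K) ^ n \<le> ((K + 1) / K) ^ (2 * n)" for n
    by (rule power_increasing) (use K in auto)
  ultimately have "\<not> p > 0"
    by (metis (no_types, opaque_lifting) divide_less_eq linorder_not_less mult.commute order_less_le_trans)
  then have "p = 0" by (simp add: p_def measure_le_0_iff not_less)
  then have "AE \<omega> in M. \<not> K + 1 \<le> \<bar>Y \<omega>\<bar>"
    using prob_eq_0[of "{\<omega> \<in> space M. K + 1 \<le> \<bar>Y \<omega>\<bar>}"] by (simp add: p_def)
  then show ?thesis by eventually_elim auto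
qed

section \<open>Indeterminacy of the moments for q > 1\<close>

text \<open>
  For \<open>q > 1\<close> put \<open>x = c * sinh \<xi>\<close> with \<open>c\<^sup>2 = 4 / (q - 1)\<close>. The functional with
  moments \<open>q_moment q n 0\<close> is then integration of functions of \<open>x\<close> against
  \<open>cosh \<xi>\<close> times a Gaussian weight in \<open>\<xi>\<close> of variance \<open>ln q / 4\<close>. Only one property of the
  Gaussian enters: multiplication by \<open>exp (2 * \<xi>)\<close> or \<open>exp (- (2 * \<xi>))\<close> is the same, up to a
  constant, as a translation by \<open>\<tau> = ln q / 2\<close>. The property survives multiplication of the
  weight by any \<open>\<tau>\<close>-periodic function, which produces many laws with the same moments.
\<close>

lemma q_power_eq: "q ^ n = 1 + (q - 1) * q_number q n"
proof (induction n)
  case (Suc n)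
  show ?case unfolding power_Suc Suc q_number_Suc by (simp add: algebra_simps)
qed simp

text \<open>
  With \<open>s = exp \<tau>\<close> and \<open>x = c * sinh \<xi>\<close>, the arguments of \<open>f\<close> and \<open>g\<close> are
  \<open>c * sinh (\<xi> + \<tau>)\<close> and \<open>c * sinh (\<xi> - \<tau>)\<close>. The difference is the Askey-Wilson
  divided difference, which lowers the degree; the sum is carried along because the two three-term
  recurrences only close up together.
\<close>

lemma q_hermite_shift:
  fixes s x y :: real and n :: nat
  defines "q \<equiv> s\<^sup>2"
  defines "f \<equiv> (\<lambda>n. q_hermite q n ((s + 1 / s) / 2 * x + y))"
    and "g \<equiv> (\<lambda>n. q_hermite q n ((s + 1 / s) / 2 * x - y))"
  assumes s: "s \<noteq> 0" and y: "(s * y)\<^sup>2 = ((q - 1) / 2)\<^sup>2 * x\<^sup>2 + q - 1"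
  shows "s ^ n * (f n - g n) = 2 * (s * y) * q_number q n * q_hermite q (n - 1) x \<and>
    s ^ n * (f n + g n) = (q ^ n + 1) * q_hermite q n x
      + (q - 1) * q_number q n * q_number q (n - 1) * q_hermite q (n - 2) x"
proof (induction n rule: induct_nat_012)
  case 0
  then show ?case by (simp add: f_def g_def)
next
  case 1
  then show ?case using s by (simp add: f_def g_def q_number_def q_def power2_eq_square field_simps)
next
  case (ge2 n)
  define z where "z = s * y"
  define p where "p i = q_hermite q i x" for i
  define k k1 where "k = q_number q n" and "k1 = q_number q (Suc n)"
  have k1: "k1 = q * k + 1" by (simp add: k1_def k_def q_number_Suc)
  have c: "s * ((s + 1 / s) / 2) = (q + 1) / 2" using s by (simp add: q_def power2_eq_square field_simps)
  have zz: "z\<^sup>2 = ((q - 1) / 2)\<^sup>2 * x\<^sup>2 + q - 1" using y by (simp add: z_def)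
  define d a d1 a1 where "d = s ^ n * (f n - g n)" and "a = s ^ n * (f n + g n)"
    and "d1 = s ^ Suc n * (f (Suc n) - g (Suc n))" and "a1 = s ^ Suc n * (f (Suc n) + g (Suc n))"
  have d: "d = 2 * z * k * p (n - 1)" and d1: "d1 = 2 * z * k1 * p n"
    and a: "a = (2 + (q - 1) * k) * p n + (q - 1) * k * q_number q (n - 1) * p (n - 2)"
    and a1: "a1 = (2 + (q - 1) * k1) * p (Suc n) + (q - 1) * k1 * k * p (n - 1)"
    using ge2 by (simp_all add: d_def a_def d1_def a1_def z_def k_def k1_def p_def q_power_eq del: power_Suc)
  have f: "f (Suc (Suc n)) = ((s + 1 / s) / 2 * x + y) * f (Suc n) - k1 * f n"
    and g: "g (Suc (Suc n)) = ((s + 1 / s) / 2 * x - y) * g (Suc n) - k1 * g n"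
    by (simp_all add: f_def g_def k1_def)
  \<comment> \<open>the recurrences of \<open>f\<close> and \<open>g\<close> in terms of scaled differences \<open>d\<close> and sums \<open>a\<close>\<close>
  have d2: "s ^ Suc (Suc n) * (f (Suc (Suc n)) - g (Suc (Suc n))) = (q + 1) / 2 * x * d1 + z * a1 - k1 * q * d"
    and a2: "s ^ Suc (Suc n) * (f (Suc (Suc n)) + g (Suc (Suc n))) = (q + 1) / 2 * x * a1 + z * d1 - k1 * q * a"
    unfolding f g c[symmetric] z_def d_def a_def d1_def a1_def q_def by (simp_all add: power2_eq_square algebra_simps)
  have p1: "x * p n = p (Suc n) + k * p (n - 1)" and p2: "x * p (Suc n) = p (Suc (Suc n)) + k1 * p n"
    using times_q_hermite[of x q n] times_q_hermite[of x q "Suc n"] by (simp_all add: p_def k_def k1_def)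
  have p0: "k * (x * p (n - 1)) = k * (p n + q_number q (n - 1) * p (n - 2))"
    using q_number_mult_q_hermite_pred[of q n x] by (simp add: p_def k_def)
  have "(q + 1) / 2 * x * d1 + z * a1 - k1 * q * d =
     2 * z * ((q + 1) / 2 * k1 * (x * p n) + (2 + (q - 1) * k1) / 2 * p (Suc n)
         + (q - 1) / 2 * k1 * k * p (n - 1) - k1 * q * k * p (n - 1))"
    by (simp add: d1 a1 d field_simps)
  also have "\<dots> = 2 * z * (q * k1 + 1) * p (Suc n)"
    unfolding p1 by (simp add: field_simps)
  finally have D: "(q + 1) / 2 * x * d1 + z * a1 - k1 * q * d = 2 * z * q_number q (Suc (Suc n)) * p (Suc n)"
    by (simp add: q_number_Suc[of q "Suc n"] k1_def)
  have xx: "x\<^sup>2 * p n = p (Suc (Suc n)) + k1 * p n + k * (p n + q_number q (n - 1) * p (n - 2))"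
    using p0 p1 p2 by (simp add: power2_eq_square algebra_simps)
  have "(q + 1) / 2 * x * a1 + z * d1 - k1 * q * a =
     (q + 1) / 2 * (2 + (q - 1) * k1) * (x * p (Suc n)) + (q + 1) / 2 * (q - 1) * k1 * (k * (x * p (n - 1)))
      + 2 * z\<^sup>2 * k1 * p n - k1 * q * a"
    by (simp add: d1 a1 power2_eq_square field_simps)
  also have "\<dots> = (q + 1) / 2 * (2 + (q - 1) * k1) * (x * p (Suc n)) + (q + 1) / 2 * (q - 1) * k1 * (k * (x * p (n - 1)))
      + 2 * k1 * (((q - 1) / 2)\<^sup>2 * (x\<^sup>2 * p n) + (q - 1) * p n) - k1 * q * a"
    unfolding zz by (simp add: algebra_simps)
  also have "\<dots> = (2 + (q - 1) * (q * k1 + 1)) * p (Suc (Suc n)) + (q - 1) * (q * k1 + 1) * k1 * p n"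
    unfolding xx p0 p2 a k1 by (simp add: power2_eq_square field_simps)
  finally have A: "(q + 1) / 2 * x * a1 + z * d1 - k1 * q * a =
      (2 + (q - 1) * q_number q (Suc (Suc n))) * p (Suc (Suc n)) + (q - 1) * q_number q (Suc (Suc n)) * k1 * p n"
    by (simp add: q_number_Suc[of q "Suc n"] k1_def)
  show ?case
    unfolding d2 a2 D A by (simp add: z_def p_def k1_def q_power_eq del: power_Suc)
qed


lemma borel_measurable_sinh [measurable]: "(sinh :: real \<Rightarrow> real) \<in> borel_measurable borel"
  by (intro borel_measurable_continuous_onI continuous_intros)

lemma borel_measurable_cosh [measurable]: "(cosh :: real \<Rightarrow> real) \<in> borel_measurable borel"
  by (intro borel_measurable_continuous_onI continuous_intros)

definition gauss_weight :: "real \<Rightarrow> real \<Rightarrow> real" where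
  "gauss_weight q \<xi> = exp (- 2 * \<xi>\<^sup>2 / ln q)"

lemma gauss_weight_pos [simp]: "gauss_weight q \<xi> > 0"
  by (simp add: gauss_weight_def)

lemma borel_measurable_gauss_weight [measurable]: "gauss_weight q \<in> borel_measurable borel"
  unfolding gauss_weight_def[abs_def] by measurable

lemma gauss_weight_shift:
  assumes "q > 1"
  shows "exp (2 * \<xi>) * gauss_weight q \<xi> = sqrt q * gauss_weight q (\<xi> - ln q / 2)"
    and "exp (- (2 * \<xi>)) * gauss_weight q \<xi> = sqrt q * gauss_weight q (\<xi> + ln q / 2)"
proof -
  have s: "sqrt q = exp (ln q / 2)" using assms by (simp add: ln_sqrt[symmetric])
  show "exp (2 * \<xi>) * gauss_weight q \<xi> = sqrt q * gauss_weight q (\<xi> - ln q / 2)"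
    "exp (- (2 * \<xi>)) * gauss_weight q \<xi> = sqrt q * gauss_weight q (\<xi> + ln q / 2)"
    using assms unfolding s gauss_weight_def exp_add[symmetric]
    by (simp_all add: power2_eq_square field_simps)
qed

text \<open>Completing the square turns the integrand into a multiple of a normal density.\<close>

lemma integrable_exp_gauss_weight:
  assumes "q > 1"
  shows "integrable lborel (\<lambda>\<xi>. exp (j * \<xi>) * gauss_weight q \<xi>)"
proof -
  define L where "L = ln q"
  have L: "L > 0" using assms by (simp add: L_def)
  define \<sigma> where "\<sigma> = sqrt L / 2"
  have \<sigma>: "\<sigma> > 0" "\<sigma>\<^sup>2 = L / 4" using L by (simp_all add: \<sigma>_def power_divide)
  have "j * \<xi> + - 2 * \<xi>\<^sup>2 / L = j\<^sup>2 * L / 8 + - (\<xi> - j * L / 4)\<^sup>2 / (2 * (L / 4))" for \<xi>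
    using L by (simp add: power2_eq_square field_simps)
  then have "exp (j * \<xi>) * gauss_weight q \<xi> =
      (exp (j\<^sup>2 * L / 8) * sqrt (2 * pi * (L / 4))) * normal_density (j * L / 4) \<sigma> \<xi>" for \<xi>
    using L unfolding gauss_weight_def exp_add[symmetric] normal_density_def \<sigma>(2) L_def[symmetric]
    by (simp add: mult_exp_exp)
  then show ?thesis using integrable_normal_density[OF \<sigma>(1)] by simp
qed

locale periodic_weight =
  fixes q :: real and w :: "real \<Rightarrow> real"
  assumes q: "q > 1"
    and w_measurable [measurable]: "w \<in> borel_measurable borel"
    and w_bounds: "\<And>\<xi>. 0 \<le> w \<xi>" "\<And>\<xi>. w \<xi> \<le> 1"
    and w_periodic: "\<And>\<xi>. w (\<xi> + ln q / 2) = w \<xi>"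
    and w_nontrivial: "\<not> (AE \<xi> in lborel. w \<xi> = 0)"
begin

definition \<tau> :: real where "\<tau> = ln q / 2"
definition c :: real where "c = 2 / sqrt (q - 1)"

lemma c_pos: "c > 0" and c_square: "c\<^sup>2 = 4 / (q - 1)"
  using q by (simp_all add: c_def power_divide)

definition weight :: "real \<Rightarrow> real" where
  "weight \<xi> = gauss_weight q \<xi> * w \<xi>"

lemma weight_measurable [measurable]: "weight \<in> borel_measurable borel"
  unfolding weight_def[abs_def] by measurable

lemma weight_nonneg: "weight \<xi> \<ge> 0"
  using w_bounds by (simp add: weight_def less_imp_le)

lemma weight_shift:
  "exp (2 * \<xi>) * weight \<xi> = sqrt q * weight (\<xi> - \<tau>)"
  "exp (- (2 * \<xi>)) * weight \<xi> = sqrt q * weight (\<xi> + \<tau>)"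
proof -
  have "w (\<xi> - \<tau>) = w \<xi>" "w (\<xi> + \<tau>) = w \<xi>"
    using w_periodic[of \<xi>] w_periodic[of "\<xi> - \<tau>"] by (simp_all add: \<tau>_def)
  then show "exp (2 * \<xi>) * weight \<xi> = sqrt q * weight (\<xi> - \<tau>)"
    "exp (- (2 * \<xi>)) * weight \<xi> = sqrt q * weight (\<xi> + \<tau>)"
    unfolding weight_def mult.assoc[symmetric] gauss_weight_shift[OF q] \<tau>_def by simp_all
qed

lemma integrable_exp_weight:
  "integrable lborel (\<lambda>\<xi>. exp (j * \<xi>) * weight \<xi>)"
proof (rule Bochner_Integration.integrable_bound[OF integrable_exp_gauss_weight[OF q, of j]])
  have "\<bar>weight \<xi>\<bar> \<le> \<bar>gauss_weight q \<xi>\<bar>" for \<xi>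
    unfolding weight_def abs_mult using w_bounds[of \<xi>] by (intro mult_left_le) auto
  then show "AE \<xi> in lborel. norm (exp (j * \<xi>) * weight \<xi>) \<le> norm (exp (j * \<xi>) * gauss_weight q \<xi>)"
    unfolding real_norm_def abs_mult by (intro AE_I2 mult_left_mono) auto
qed simp

lemma integrable_sinh_power_weight:
  "integrable lborel (\<lambda>\<xi>. (c * sinh \<xi>) ^ n * (exp (j * \<xi>) * weight \<xi>))"
proof (rule Bochner_Integration.integrable_bound)
  show "integrable lborel (\<lambda>\<xi>. c ^ n * (exp ((real n + j) * \<xi>) * weight \<xi> + exp ((- real n + j) * \<xi>) * weight \<xi>))"
    by (intro integrable_mult_right Bochner_Integration.integrable_add integrable_exp_weight)
  have "\<bar>sinh \<xi>\<bar> ^ n \<le> exp (real n * \<xi>) + exp (- real n * \<xi>)" for \<xi> :: real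
  proof -
    have "exp \<xi> \<le> exp \<bar>\<xi>\<bar>" "exp (- \<xi>) \<le> exp \<bar>\<xi>\<bar>" "exp \<xi> > 0" "exp (- \<xi>) > 0" by simp_all
    moreover have "\<bar>(u - v) / 2\<bar> \<le> e" if "u \<le> e" "v \<le> e" "u > 0" "v > 0" for u v e :: real
      using that by (simp add: abs_le_iff)
    ultimately have "\<bar>sinh \<xi>\<bar> \<le> exp \<bar>\<xi>\<bar>" unfolding sinh_field_def by blast
    then have "\<bar>sinh \<xi>\<bar> ^ n \<le> exp \<bar>\<xi>\<bar> ^ n" by (simp add: power_mono)
    also have "\<dots> \<le> exp (real n * \<xi>) + exp (- real n * \<xi>)"
      by (auto simp: exp_of_nat_mult[symmetric] abs_real_def)
    finally show ?thesis .
  qed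
  then have S: "\<bar>c * sinh \<xi>\<bar> ^ n \<le> c ^ n * (exp (real n * \<xi>) + exp (- real n * \<xi>))" for \<xi>
    unfolding abs_mult power_mult_distrib using c_pos by (simp add: mult_left_mono)
  have "norm ((c * sinh \<xi>) ^ n * (exp (j * \<xi>) * weight \<xi>)) \<le>
     norm (c ^ n * (exp ((real n + j) * \<xi>) * weight \<xi> + exp ((- real n + j) * \<xi>) * weight \<xi>))" for \<xi>
  proof -
    have E: "exp (j * \<xi>) * weight \<xi> \<ge> 0" using weight_nonneg by simp
    have "norm ((c * sinh \<xi>) ^ n * (exp (j * \<xi>) * weight \<xi>)) = \<bar>c * sinh \<xi>\<bar> ^ n * (exp (j * \<xi>) * weight \<xi>)"
      using E by (simp only: real_norm_def abs_mult[of "(c * sinh \<xi>) ^ n"] power_abs abs_of_nonneg)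
    also have "\<dots> \<le> c ^ n * (exp (real n * \<xi>) + exp (- real n * \<xi>)) * (exp (j * \<xi>) * weight \<xi>)"
      by (rule mult_right_mono[OF S E])
    also have "\<dots> = c ^ n * (exp ((real n + j) * \<xi>) * weight \<xi> + exp ((- real n + j) * \<xi>) * weight \<xi>)"
      by (simp only: distrib_left distrib_right exp_add mult.assoc)
    finally show ?thesis unfolding real_norm_def by (rule order_trans[OF _ abs_ge_self])
  qed
  then show "AE \<xi> in lborel. norm ((c * sinh \<xi>) ^ n * (exp (j * \<xi>) * weight \<xi>)) \<le>
     norm (c ^ n * (exp ((real n + j) * \<xi>) * weight \<xi> + exp ((- real n + j) * \<xi>) * weight \<xi>))"
    by simp
qed simp

lemma integrable_q_hermite_weight:
  "integrable lborel (\<lambda>\<xi>. q_hermite q n (c * sinh \<xi>) * (exp (j * \<xi>) * weight \<xi>))"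
proof -
  let ?D = "density lborel (\<lambda>\<xi>. ennreal (exp (j * \<xi>) * weight \<xi>))"
  have "integrable ?D (\<lambda>\<xi>. (c * sinh \<xi>) ^ n)" for n
    using integrable_sinh_power_weight[of n j] weight_nonneg
    by (subst integrable_real_density) (auto simp: mult_ac)
  from integrable_power_times_q_hermite[OF this, of 0] show ?thesis
    using weight_nonneg by (subst (asm) integrable_real_density) (auto simp: mult_ac)
qed

definition G :: "(real \<Rightarrow> real) \<Rightarrow> real" where
  "G f = (\<integral>\<xi>. f \<xi> * weight \<xi> \<partial>lborel)"

text \<open>Translation by \<open>\<plusminus> \<tau>\<close> in the integral absorbs the exponential factor into the weight.\<close>

lemma G_exp_shift:
  fixes n
  defines "p \<equiv> \<lambda>\<xi>. q_hermite q n (c * sinh \<xi>)"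
  shows "integrable lborel (\<lambda>\<xi>. p (\<xi> + \<tau>) * weight \<xi>)" "G (\<lambda>\<xi>. p \<xi> * exp (2 * \<xi>)) = sqrt q * G (\<lambda>\<xi>. p (\<xi> + \<tau>))"
    and "integrable lborel (\<lambda>\<xi>. p (\<xi> - \<tau>) * weight \<xi>)" "G (\<lambda>\<xi>. p \<xi> * exp (- (2 * \<xi>))) = sqrt q * G (\<lambda>\<xi>. p (\<xi> - \<tau>))"
proof -
  have e: "p \<xi> * exp (2 * \<xi>) * weight \<xi> = sqrt q * (p ((\<xi> - \<tau>) + \<tau>) * weight (\<xi> - \<tau>))"
    "p \<xi> * exp (- (2 * \<xi>)) * weight \<xi> = sqrt q * (p ((\<xi> + \<tau>) - \<tau>) * weight (\<xi> + \<tau>))" for \<xi>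
    using weight_shift[of \<xi>] by (simp_all add: mult.assoc mult.left_commute)
  have i1: "integrable lborel (\<lambda>\<xi>. p ((\<xi> - \<tau>) + \<tau>) * weight (\<xi> - \<tau>))"
    using integrable_q_hermite_weight[of n 2] q
    unfolding weight_shift(1) mult.left_commute[of _ "sqrt q"] by (simp add: p_def)
  have i2: "integrable lborel (\<lambda>\<xi>. p ((\<xi> + \<tau>) - \<tau>) * weight (\<xi> + \<tau>))"
    using integrable_q_hermite_weight[of n "-2"] q
    unfolding mult_minus_left weight_shift(2) mult.left_commute[of _ "sqrt q"] by (simp add: p_def)
  show "integrable lborel (\<lambda>\<xi>. p (\<xi> + \<tau>) * weight \<xi>)"
    using i1 lborel_integrable_real_affine_iff[of 1 "\<lambda>\<xi>. p (\<xi> + \<tau>) * weight \<xi>" "- \<tau>"] by (simp add: add.commute)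
  show "integrable lborel (\<lambda>\<xi>. p (\<xi> - \<tau>) * weight \<xi>)"
    using i2 lborel_integrable_real_affine_iff[of 1 "\<lambda>\<xi>. p (\<xi> - \<tau>) * weight \<xi>" "\<tau>"] by (simp add: add.commute)
  show "G (\<lambda>\<xi>. p \<xi> * exp (2 * \<xi>)) = sqrt q * G (\<lambda>\<xi>. p (\<xi> + \<tau>))"
    using lborel_integral_real_affine[of 1 "\<lambda>\<xi>. p (\<xi> + \<tau>) * weight \<xi>" "- \<tau>"]
    unfolding G_def e by (simp add: add.commute)
  show "G (\<lambda>\<xi>. p \<xi> * exp (- (2 * \<xi>))) = sqrt q * G (\<lambda>\<xi>. p (\<xi> - \<tau>))"
    using lborel_integral_real_affine[of 1 "\<lambda>\<xi>. p (\<xi> - \<tau>) * weight \<xi>" "\<tau>"]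
    unfolding G_def e by (simp add: add.commute)
qed

lemma integrable_cosh_q_hermite_weight:
  "integrable lborel (\<lambda>\<xi>. cosh \<xi> * q_hermite q n (c * sinh \<xi>) * weight \<xi>)"
proof -
  have "cosh \<xi> * q_hermite q n (c * sinh \<xi>) * weight \<xi> =
     1 / 2 * (q_hermite q n (c * sinh \<xi>) * (exp (1 * \<xi>) * weight \<xi>)
     + q_hermite q n (c * sinh \<xi>) * (exp (- 1 * \<xi>) * weight \<xi>))" for \<xi>
    by (simp add: cosh_def field_simps)
  then show ?thesis
    by (simp only:) (intro integrable_mult_right Bochner_Integration.integrable_add integrable_q_hermite_weight)
qed

text \<open>
  Since \<open>4 * cosh \<xi> * sinh \<xi> = exp (2 * \<xi>) - exp (- (2 * \<xi>))\<close>, multiplication by \<open>x\<close> under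
  \<open>G\<close> with the factor \<open>cosh \<xi>\<close> becomes a difference of two translates, and \<open>q_hermite_shift\<close>
  turns that difference into a polynomial of lower degree.
\<close>

lemma G_times_q_hermite:
  "G (\<lambda>\<xi>. cosh \<xi> * (c * sinh \<xi> * q_hermite q n (c * sinh \<xi>))) =
     sqrt q / sqrt q ^ n * q_number q n * G (\<lambda>\<xi>. cosh \<xi> * q_hermite q (n - 1) (c * sinh \<xi>))"
proof -
  let ?p = "\<lambda>n \<xi>. q_hermite q n (c * sinh \<xi>)"
  let ?s = "sqrt q"
  have s: "?s > 1" "?s \<noteq> 0" "?s\<^sup>2 = q" using q by auto
  have ch: "cosh \<tau> = (?s + 1 / ?s) / 2" and sh: "sinh \<tau> = (?s - 1 / ?s) / 2"
    using q by (simp_all add: \<tau>_def cosh_def sinh_def exp_minus ln_sqrt[symmetric] inverse_eq_divide)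
  have shift: "?p n (\<xi> + \<tau>) - ?p n (\<xi> - \<tau>) =
      2 * ?s * c * sinh \<tau> / ?s ^ n * q_number q n * (cosh \<xi> * ?p (n - 1) \<xi>)" for \<xi>
  proof -
    let ?y = "c * cosh \<xi> * sinh \<tau>"
    have "(?s * ?y)\<^sup>2 = (?s * sinh \<tau>)\<^sup>2 * (c\<^sup>2 + (c * sinh \<xi>)\<^sup>2)"
      using cosh_square_eq[of \<xi>] by (simp add: power_mult_distrib algebra_simps)
    also have "(?s * sinh \<tau>)\<^sup>2 = ((q - 1) / 2)\<^sup>2"
      using s unfolding sh by (simp add: right_diff_distrib power2_eq_square)
    finally have y: "(?s * ?y)\<^sup>2 = ((?s\<^sup>2 - 1) / 2)\<^sup>2 * (c * sinh \<xi>)\<^sup>2 + ?s\<^sup>2 - 1"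
      using q unfolding c_square s(3) distrib_left by (simp add: power2_eq_square)
    have x: "c * sinh (\<xi> + \<tau>) = (?s + 1 / ?s) / 2 * (c * sinh \<xi>) + ?y"
      "c * sinh (\<xi> - \<tau>) = (?s + 1 / ?s) / 2 * (c * sinh \<xi>) - ?y"
      unfolding ch[symmetric] by (simp_all add: sinh_add sinh_diff algebra_simps)
    have "?s ^ n * (?p n (\<xi> + \<tau>) - ?p n (\<xi> - \<tau>)) = 2 * (?s * ?y) * q_number q n * ?p (n - 1) \<xi>"
      using q_hermite_shift[OF s(2) y, of n] unfolding x[symmetric] s(3) by simp
    then have "?p n (\<xi> + \<tau>) - ?p n (\<xi> - \<tau>) = 2 * (?s * ?y) * q_number q n * ?p (n - 1) \<xi> / ?s ^ n"
      using s(2) by (simp add: nonzero_eq_divide_eq mult.commute)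
    then show ?thesis by simp
  qed
  have e: "cosh \<xi> * (c * sinh \<xi> * ?p n \<xi>) * weight \<xi> =
      c / 4 * (?p n \<xi> * exp (2 * \<xi>) * weight \<xi> - ?p n \<xi> * exp (- (2 * \<xi>)) * weight \<xi>)" for \<xi>
  proof -
    have "cosh \<xi> * sinh \<xi> = (exp (2 * \<xi>) - exp (- (2 * \<xi>))) / 4"
      using sinh_double[of \<xi>] sinh_field_def[of "2 * \<xi>"] by simp
    moreover have "cosh \<xi> * (c * sinh \<xi> * ?p n \<xi>) * weight \<xi> = c * (cosh \<xi> * sinh \<xi>) * ?p n \<xi> * weight \<xi>"
      by simp
    ultimately show ?thesis by (simp only: left_diff_distrib right_diff_distrib diff_divide_distrib) (simp add: mult_ac)
  qed
  have "G (\<lambda>\<xi>. cosh \<xi> * (c * sinh \<xi> * ?p n \<xi>)) = c / 4 * (G (\<lambda>\<xi>. ?p n \<xi> * exp (2 * \<xi>)) - G (\<lambda>\<xi>. ?p n \<xi> * exp (- (2 * \<xi>))))"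
    unfolding G_def e using integrable_q_hermite_weight[of n 2] integrable_q_hermite_weight[of n "-2"]
    by (subst Bochner_Integration.integral_diff[symmetric]) (auto simp: mult.assoc)
  also have "\<dots> = c / 4 * ?s * (G (\<lambda>\<xi>. ?p n (\<xi> + \<tau>)) - G (\<lambda>\<xi>. ?p n (\<xi> - \<tau>)))"
    unfolding G_exp_shift by (simp add: right_diff_distrib)
  also have "G (\<lambda>\<xi>. ?p n (\<xi> + \<tau>)) - G (\<lambda>\<xi>. ?p n (\<xi> - \<tau>)) = G (\<lambda>\<xi>. ?p n (\<xi> + \<tau>) - ?p n (\<xi> - \<tau>))"
    unfolding G_def left_diff_distrib using G_exp_shift(1,3)
    by (subst Bochner_Integration.integral_diff) auto
  also have "\<dots> = 2 * ?s * c * sinh \<tau> / ?s ^ n * q_number q n * G (\<lambda>\<xi>. cosh \<xi> * ?p (n - 1) \<xi>)"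
    unfolding G_def shift by (simp add: mult.assoc)
  also have "c / 4 * ?s * (2 * ?s * c * sinh \<tau> / ?s ^ n * q_number q n * G (\<lambda>\<xi>. cosh \<xi> * ?p (n - 1) \<xi>)) =
    (c\<^sup>2 * (?s * sinh \<tau>) / 2) * (?s / ?s ^ n) * q_number q n * G (\<lambda>\<xi>. cosh \<xi> * ?p (n - 1) \<xi>)"
    by (simp add: power2_eq_square)
  also have "c\<^sup>2 * (?s * sinh \<tau>) / 2 = 1"
    using q s unfolding c_square sh by (simp add: field_simps power2_eq_square)
  finally show ?thesis by simp
qed

text \<open>
  By the three-term recurrence and the previous lemma, the value at degree \<open>n + 1\<close> is
  \<open>(sqrt q / sqrt q ^ n - 1) * q_number q n\<close> times the value at degree \<open>n - 1\<close>. The factor vanishes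
  for \<open>n = 0\<close> and \<open>n = 1\<close>, which starts the induction.
\<close>

lemma G_q_hermite_eq_0: "G (\<lambda>\<xi>. cosh \<xi> * q_hermite q (Suc n) (c * sinh \<xi>)) = 0"
proof (induction n rule: less_induct)
  case (less n)
  let ?p = "\<lambda>n \<xi>. cosh \<xi> * q_hermite q n (c * sinh \<xi>)"
  have "G (?p (Suc n)) + q_number q n * G (?p (n - 1)) =
      G (\<lambda>\<xi>. cosh \<xi> * (c * sinh \<xi> * q_hermite q n (c * sinh \<xi>)))"
    unfolding G_def times_q_hermite
    using integrable_cosh_q_hermite_weight[of "Suc n"] integrable_cosh_q_hermite_weight[of "n - 1"]
    by (simp add: distrib_left distrib_right mult.left_commute[of _ "q_number q n"] mult.assoc)
  then have *: "G (?p (Suc n)) = (sqrt q / sqrt q ^ n - 1) * q_number q n * G (?p (n - 1))"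
    unfolding G_times_q_hermite by (simp add: algebra_simps)
  show ?case
  proof (cases "n \<le> 1")
    case True
    then have "n = 0 \<or> n = 1" by linarith
    then have "(sqrt q / sqrt q ^ n - 1) * q_number q n = 0" using q by auto
    then show ?thesis unfolding * by (simp only: mult_zero_left)
  next
    case False
    then have "n - 2 < n" "Suc (n - 2) = n - 1" by auto
    then have "G (?p (n - 1)) = 0" using less[of "n - 2"] by presburger
    then show ?thesis unfolding * by (simp only: mult_zero_right)
  qed
qed

definition total_mass :: real where
  "total_mass = G cosh"

lemma total_mass_pos: "total_mass > 0"
proof -
  have i: "integrable lborel (\<lambda>\<xi>. cosh \<xi> * weight \<xi>)"
    using integrable_cosh_q_hermite_weight[of 0] by simp
  have nn: "0 \<le> cosh \<xi> * weight \<xi>" for \<xi>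
    using weight_nonneg[of \<xi>] by simp
  have "total_mass \<noteq> 0"
  proof
    assume "total_mass = 0"
    then have "AE \<xi> in lborel. cosh \<xi> * weight \<xi> = 0"
      using integral_nonneg_eq_0_iff_AE[OF i] nn by (simp add: total_mass_def G_def)
    then have "AE \<xi> in lborel. w \<xi> = 0"
      by eventually_elim (auto simp: weight_def less_imp_neq[OF gauss_weight_pos, symmetric])
    then show False using w_nontrivial by simp
  qed
  moreover have "total_mass \<ge> 0"
    unfolding total_mass_def G_def using nn by simp
  ultimately show ?thesis by simp
qed

definition parameter_law :: "real measure" where
  "parameter_law = density lborel (\<lambda>\<xi>. ennreal (cosh \<xi> * weight \<xi> / total_mass))"

definition law :: "real measure" where
  "law = distr parameter_law borel (\<lambda>\<xi>. c * sinh \<xi>)"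

lemma density_nonneg: "0 \<le> cosh \<xi> * weight \<xi> / total_mass"
  using total_mass_pos weight_nonneg[of \<xi>] by simp

lemma prob_space_parameter_law: "prob_space parameter_law"
proof
  have "integrable lborel (\<lambda>\<xi>. cosh \<xi> * weight \<xi> / total_mass)"
    using integrable_cosh_q_hermite_weight[of 0] by simp
  then have "emeasure parameter_law UNIV = ennreal (\<integral>\<xi>. cosh \<xi> * weight \<xi> / total_mass \<partial>lborel)"
    unfolding parameter_law_def using density_nonneg by (simp add: emeasure_density nn_integral_eq_integral)
  also have "\<dots> = 1"
    using total_mass_pos by (simp add: total_mass_def G_def)
  finally show "emeasure parameter_law (space parameter_law) = 1"
    by (simp add: parameter_law_def)
qed

lemma measurable_parameter [measurable]: "(\<lambda>\<xi>. c * sinh \<xi>) \<in> borel_measurable parameter_law"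
  unfolding parameter_law_def by simp

lemma integrable_parameter_power: "integrable parameter_law (\<lambda>\<xi>. (c * sinh \<xi>) ^ n)"
proof -
  have "cosh \<xi> * weight \<xi> / total_mass * (c * sinh \<xi>) ^ n =
     1 / (2 * total_mass) * ((c * sinh \<xi>) ^ n * (exp (1 * \<xi>) * weight \<xi>) + (c * sinh \<xi>) ^ n * (exp (- 1 * \<xi>) * weight \<xi>))" for \<xi>
    by (simp add: cosh_def field_simps)
  moreover have "integrable lborel (\<lambda>\<xi>. 1 / (2 * total_mass) * ((c * sinh \<xi>) ^ n * (exp (1 * \<xi>) * weight \<xi>) + (c * sinh \<xi>) ^ n * (exp (- 1 * \<xi>) * weight \<xi>)))"
    by (intro integrable_mult_right Bochner_Integration.integrable_add integrable_sinh_power_weight)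
  ultimately have "integrable lborel (\<lambda>\<xi>. cosh \<xi> * weight \<xi> / total_mass * (c * sinh \<xi>) ^ n)"
    by presburger
  then show ?thesis
    unfolding parameter_law_def using density_nonneg by (subst integrable_real_density) auto
qed

lemma expectation_parameter_power: "(\<integral>\<xi>. (c * sinh \<xi>) ^ n \<partial>parameter_law) = q_moment q n 0"
proof (rule prob_space.expectation_power_eq_q_moment[OF prob_space_parameter_law integrable_parameter_power])
  fix k :: nat assume "k > 0"
  then obtain m where m: "k = Suc m" using gr0_implies_Suc by blast
  have "(\<integral>\<xi>. q_hermite q k (c * sinh \<xi>) \<partial>parameter_law) =
      (\<integral>\<xi>. cosh \<xi> * weight \<xi> / total_mass * q_hermite q k (c * sinh \<xi>) \<partial>lborel)"
    unfolding parameter_law_def using density_nonneg by (subst integral_real_density) auto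
  also have "\<dots> = G (\<lambda>\<xi>. cosh \<xi> * q_hermite q k (c * sinh \<xi>)) / total_mass"
    unfolding G_def by (simp add: mult_ac)
  also have "\<dots> = 0" unfolding m G_q_hermite_eq_0 by simp
  finally show "(\<integral>\<xi>. q_hermite q k (c * sinh \<xi>) \<partial>parameter_law) = 0" .
qed

lemma law_moments:
  "prob_space law" "sets law = sets borel"
  "integrable law (\<lambda>x. x ^ n)" "(\<integral>x. x ^ n \<partial>law) = q_moment q n 0"
  using integrable_parameter_power[of n] expectation_parameter_power[of n]
  by (auto simp: law_def prob_space.prob_space_distr[OF prob_space_parameter_law] integrable_distr_eq integral_distr)

lemma AE_law: "AE x in law. w (arsinh (x / c)) > 0"
proof -
  have "(\<lambda>x. w (arsinh (x / c))) \<in> borel_measurable borel"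
    by (rule measurable_compose[OF _ w_measurable])
      (intro borel_measurable_continuous_onI continuous_intros, use c_pos in auto)
  moreover have "0 < w \<xi>" if "0 < cosh \<xi> * weight \<xi> / total_mass" for \<xi>
    using that w_bounds(1)[of \<xi>] by (cases "w \<xi> = 0") (auto simp: weight_def)
  then have "AE \<xi> in parameter_law. w (arsinh (c * sinh \<xi> / c)) > 0"
    unfolding parameter_law_def using c_pos by (subst AE_density) (auto simp: arsinh_sinh_real)
  ultimately show ?thesis
    unfolding law_def by (subst AE_distr_iff) (auto simp: pred_def)
qed

end

text \<open>
  The indicators of \<open>sin > 0\<close> and \<open>sin < 0\<close>, scaled to period \<open>ln q / 2\<close>, give laws with the same
  moments that live on disjoint sets.
\<close>

lemma q_moments_indeterminate:
  assumes "q > 1"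
  shows "\<exists>\<nu> \<nu>'. \<nu> \<noteq> \<nu>' \<and> (\<forall>\<kappa>\<in>{\<nu>, \<nu>'}. prob_space \<kappa> \<and> sets \<kappa> = sets borel \<and>
    (\<forall>n. integrable \<kappa> (\<lambda>x. x ^ n) \<and> (\<integral>x. x ^ n \<partial>\<kappa>) = q_moment q n 0))"
proof -
  define L where "L = ln q"
  have L: "L > 0" using assms by (simp add: L_def)
  define S where "S \<epsilon> = {\<xi>::real. 0 < \<epsilon> * sin (4 * pi * \<xi> / L)}" for \<epsilon> :: real
  have w: "periodic_weight q (indicator (S \<epsilon>))" if "\<epsilon> = 1 \<or> \<epsilon> = - 1" for \<epsilon>
  proof
    show "indicator (S \<epsilon>) \<in> borel_measurable borel"
      unfolding S_def by measurable
    show "indicat_real (S \<epsilon>) (\<xi> + ln q / 2) = indicator (S \<epsilon>) \<xi>" for \<xi>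
    proof -
      have "4 * pi * (\<xi> + ln q / 2) / L = 4 * pi * \<xi> / L + 2 * pi"
        using L by (simp add: L_def field_simps)
      then show ?thesis by (simp add: S_def indicator_def)
    qed
    show "\<not> (AE \<xi> in lborel. indicat_real (S \<epsilon>) \<xi> = 0)"
    proof
      define I where "I = (if \<epsilon> = 1 then {0<..<L / 4} else {- L / 4<..<0})"
      have "I \<subseteq> S \<epsilon>"
      proof
        fix \<xi> assume \<xi>: "\<xi> \<in> I"
        have small: "0 < \<bar>\<xi>\<bar>" "4 * \<bar>\<xi>\<bar> < L" using \<xi> by (auto simp: I_def split: if_splits)
        have "4 * pi * \<bar>\<xi>\<bar> / L < pi"
          using mult_strict_left_mono[OF small(2) pi_gt_zero] L by (simp add: pos_divide_less_eq mult_ac)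
        then have "0 < sin (4 * pi * \<bar>\<xi>\<bar> / L)"
          using small(1) L by (intro sin_gt_zero) auto
        then show "\<xi> \<in> S \<epsilon>"
          using \<xi> that by (auto simp: I_def S_def split: if_splits)
      qed
      moreover assume "AE \<xi> in lborel. indicat_real (S \<epsilon>) \<xi> = 0"
      ultimately have "AE \<xi> in lborel. \<xi> \<notin> I"
        by (auto simp: indicator_def elim!: eventually_mono)
      then have "emeasure lborel I = 0"
        by (subst (asm) AE_iff_measurable[of I]) (auto simp: I_def)
      then show False using L by (auto simp: I_def split: if_splits)
    qed
  qed (use assms in auto)
  interpret P: periodic_weight q "indicator (S 1)" by (rule w) simp
  interpret N: periodic_weight q "indicator (S (- 1))" by (rule w) simp
  have "P.law \<noteq> N.law"
  proof
    assume eq: "P.law = N.law"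
    have "AE x in P.law. False"
      using P.AE_law N.AE_law unfolding eq[symmetric]
      by eventually_elim (auto simp: S_def indicator_def split: if_splits)
    then show False using P.law_moments(1) prob_space.AE_False by blast
  qed
  then show ?thesis using P.law_moments N.law_moments by blast
qed

section \<open>Bounded solutions of a linear recurrence\<close>

text \<open>
  The solutions of the recurrence are spanned by \<open>r ^ n\<close> and \<open>(1 / r) ^ n\<close>. The combination
  \<open>u (n + 1) - r * u n\<close> removes the first and grows like the second, so it must vanish.
\<close>

lemma bounded_recurrence_geometric:
  fixes u :: "nat \<Rightarrow> real"
  assumes r: "r \<noteq> 0" "\<bar>r\<bar> < 1"
    and rec: "\<And>n. (1 + r\<^sup>2) * u (Suc n) = r * (u n + u (Suc (Suc n)))"
    and bound: "\<And>n. \<bar>u n\<bar> \<le> K"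
  shows "u n = r ^ n * u 0"
proof -
  define d where "d n = u (Suc n) - r * u n" for n
  have "r * d (Suc n) = d n" for n
    using rec[of n] by (simp add: d_def power2_eq_square algebra_simps)
  then have d: "r ^ n * d n = d 0" for n
    by (induction n) (simp, metis mult.assoc power_Suc2)
  have "\<bar>d n\<bar> \<le> 2 * K" for n
  proof -
    have "\<bar>r * u n\<bar> \<le> 1 * K" unfolding abs_mult using r bound[of n] by (intro mult_mono) auto
    then show ?thesis using bound[of "Suc n"] by (simp add: d_def)
  qed
  then have "\<bar>d 0\<bar> \<le> 2 * K * \<bar>r\<bar> ^ n" for n
    unfolding d[of n, symmetric] abs_mult power_abs
    using mult_left_mono[of "\<bar>d n\<bar>" "2 * K" "\<bar>r\<bar> ^ n"] by (simp add: mult.commute)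
  moreover have "(\<lambda>n. 2 * K * \<bar>r\<bar> ^ n) \<longlonglongrightarrow> 0"
    using r by (intro tendsto_mult_right_zero LIMSEQ_realpow_zero) auto
  ultimately have "\<bar>d 0\<bar> \<le> 0"
    by (intro LIMSEQ_le_const[of _ 0]) auto
  then have "d n = 0" for n
    using d[of n] r by simp
  then have "u (Suc n) = r * u n" for n
    by (simp add: d_def)
  then show ?thesis
    by (induction n) auto
qed

text \<open>
  The quadratic equation \<open>a * (1 + r\<^sup>2) = r\<close> has two real roots with product \<open>1\<close>; the proof
  exhibits the one of smaller modulus.
\<close>

lemma reciprocal_pair:
  fixes a :: real
  assumes "\<bar>a\<bar> < 1 / 2" "a \<noteq> 0"
  obtains r where "r \<noteq> 0" "\<bar>r\<bar> < 1" "a * (1 + r\<^sup>2) = r"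
proof
  define D where "D = sqrt (1 - 4 * a\<^sup>2)"
  have "(2 * \<bar>a\<bar>)\<^sup>2 < 1\<^sup>2"
    using assms by (intro power_strict_mono) auto
  then have D: "0 < D" "D\<^sup>2 = 1 - 4 * a\<^sup>2"
    by (simp_all add: D_def power_mult_distrib)
  let ?r = "2 * a / (1 + D)"
  have n: "1 + D \<noteq> 0" using D(1) by simp
  show "?r \<noteq> 0" using assms n by simp
  show "\<bar>?r\<bar> < 1" using assms D(1) by (simp add: abs_mult)
  have "(1 + D)\<^sup>2 + (2 * a)\<^sup>2 = 2 * (1 + D)"
    using D(2) by (simp add: power2_eq_square algebra_simps)
  then have "1 + ?r\<^sup>2 = 2 * (1 + D) / (1 + D)\<^sup>2"
    using n by (simp add: power_divide add_divide_eq_iff field_simps)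
  also have "\<dots> = 2 / (1 + D)" unfolding power2_eq_square by (rule nonzero_mult_divide_mult_cancel_right[OF n])
  finally show "a * (1 + ?r\<^sup>2) = ?r" by simp
qed

section \<open>Variables with all moments\<close>

definition has_moments :: "'a measure \<Rightarrow> ('a \<Rightarrow> real) \<Rightarrow> bool" where
  "has_moments M Y \<longleftrightarrow> Y \<in> borel_measurable M \<and> (\<forall>n. integrable M (\<lambda>\<omega>. Y \<omega> ^ n))"

lemma has_momentsD:
  assumes "has_moments M Y"
  shows "Y \<in> borel_measurable M" "integrable M (\<lambda>\<omega>. Y \<omega> ^ n)" "integrable M Y"
  using assms by (auto simp: has_moments_def dest!: spec[of _ 1])

lemma integrable_times_L2:
  fixes Y Z :: "'a \<Rightarrow> real"
  assumes [measurable]: "Y \<in> borel_measurable M" "Z \<in> borel_measurable M"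
    and "integrable M (\<lambda>\<omega>. (Y \<omega>)\<^sup>2)" "integrable M (\<lambda>\<omega>. (Z \<omega>)\<^sup>2)"
  shows "integrable M (\<lambda>\<omega>. Y \<omega> * Z \<omega>)"
proof (rule Bochner_Integration.integrable_bound)
  show "integrable M (\<lambda>\<omega>. (Y \<omega>)\<^sup>2 + (Z \<omega>)\<^sup>2)"
    using assms by simp
  have "\<bar>x * y\<bar> \<le> x\<^sup>2 + y\<^sup>2" for x y :: real
    using sum_squares_bound[of x y] sum_squares_bound[of x "- y"]
      sum_power2_ge_zero[of x y] by (simp add: abs_le_iff)
  then show "AE \<omega> in M. norm (Y \<omega> * Z \<omega>) \<le> norm ((Y \<omega>)\<^sup>2 + (Z \<omega>)\<^sup>2)"
    by (auto intro: order_trans[OF _ abs_ge_self])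
qed simp

lemma has_moments_mult:
  assumes "has_moments M Y" "has_moments M Z"
  shows "has_moments M (\<lambda>\<omega>. Y \<omega> * Z \<omega>)"
  unfolding has_moments_def power_mult_distrib
  using has_momentsD[OF assms(1)] has_momentsD[OF assms(2)]
  by (auto intro!: integrable_times_L2 simp: power_mult[symmetric])

lemma has_moments_add:
  assumes "has_moments M Y" "has_moments M Z"
  shows "has_moments M (\<lambda>\<omega>. Y \<omega> + Z \<omega>)"
  unfolding has_moments_def
proof (intro conjI allI)
  note [measurable] = has_momentsD(1)[OF assms(1)] has_momentsD(1)[OF assms(2)]
  show "(\<lambda>\<omega>. Y \<omega> + Z \<omega>) \<in> borel_measurable M" by measurable
  fix n
  have Y: "integrable M (\<lambda>\<omega>. \<bar>Y \<omega>\<bar> ^ n)" and Z: "integrable M (\<lambda>\<omega>. \<bar>Z \<omega>\<bar> ^ n)"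
    using has_momentsD(2)[OF assms(1), of n] has_momentsD(2)[OF assms(2), of n]
    by (auto simp: power_abs[symmetric] dest!: integrable_abs)
  show "integrable M (\<lambda>\<omega>. (Y \<omega> + Z \<omega>) ^ n)"
  proof (rule Bochner_Integration.integrable_bound)
    show "integrable M (\<lambda>\<omega>. 2 ^ n * (\<bar>Y \<omega>\<bar> ^ n + \<bar>Z \<omega>\<bar> ^ n))"
      using Y Z by simp
    have "\<bar>x + y\<bar> ^ n \<le> 2 ^ n * (\<bar>x\<bar> ^ n + \<bar>y\<bar> ^ n)" for x y :: real
    proof -
      have "\<bar>x + y\<bar> ^ n \<le> (2 * max \<bar>x\<bar> \<bar>y\<bar>) ^ n"
        by (intro power_mono) auto
      also have "\<dots> \<le> 2 ^ n * (\<bar>x\<bar> ^ n + \<bar>y\<bar> ^ n)"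
        by (auto simp: power_mult_distrib max_def)
      finally show ?thesis .
    qed
    then show "AE \<omega> in M. norm ((Y \<omega> + Z \<omega>) ^ n) \<le> norm (2 ^ n * (\<bar>Y \<omega>\<bar> ^ n + \<bar>Z \<omega>\<bar> ^ n))"
      by (auto simp: power_abs intro!: order_trans[OF _ abs_ge_self])
  qed simp
qed

lemma (in prob_space) has_moments_const: "has_moments M (\<lambda>_. c)"
  by (simp add: has_moments_def)

lemma (in prob_space) has_moments_q_hermite:
  assumes Y: "has_moments M Y"
  shows "has_moments M (\<lambda>\<omega>. q_hermite q n (Y \<omega>))"
proof (induction n rule: induct_nat_012)
  case (ge2 n)
  have "has_moments M (\<lambda>\<omega>. Y \<omega> * q_hermite q (Suc n) (Y \<omega>) + (- q_number q (Suc n)) * q_hermite q n (Y \<omega>))"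
    by (intro has_moments_add has_moments_mult has_moments_const Y ge2)
  then show ?case by simp
qed (simp_all add: has_moments_const Y)

text \<open>
  A tail bound of the shape \<open>P(|Y| \<ge> s) \<le> D / s\<^sup>2 * P(|Y| \<ge> \<theta> s)\<close> can be iterated, so the tail decays
  faster than every power.
\<close>

lemma (in prob_space) has_moments_if_tail:
  assumes [measurable]: "random_variable borel Y"
    and \<theta>: "\<theta> > 0"
    and tail: "\<And>s. s > 0 \<Longrightarrow> prob {\<omega> \<in> space M. s \<le> \<bar>Y \<omega>\<bar>} \<le> D / s\<^sup>2 * prob {\<omega> \<in> space M. \<theta> * s \<le> \<bar>Y \<omega>\<bar>}"
  shows "has_moments M Y"
proof -
  define T where "T s = prob {\<omega> \<in> space M. s \<le> \<bar>Y \<omega>\<bar>}" for s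
  have T: "T s \<le> max D 0 / s\<^sup>2 * T (\<theta> * s)" if "s > 0" for s
    using tail[OF that] unfolding T_def
    by (rule order_trans) (auto intro!: mult_right_mono divide_right_mono)
  have "\<exists>K\<ge>0. \<forall>s>0. T s \<le> K / s ^ (2 * m)" for m
  proof (induction m)
    case 0
    show ?case by (intro exI[of _ 1]) (auto simp: T_def)
  next
    case (Suc m)
    then obtain K where K: "K \<ge> 0" "\<And>s. s > 0 \<Longrightarrow> T s \<le> K / s ^ (2 * m)" by blast
    show ?case
    proof (intro exI[of _ "max D 0 * K / \<theta> ^ (2 * m)"] conjI allI impI)
      fix s :: real assume s: "s > 0"
      have "T s \<le> max D 0 / s\<^sup>2 * (K / (\<theta> * s) ^ (2 * m))"
        using T[OF s] K(2)[of "\<theta> * s"] s \<theta> by (meson order_trans mult_left_mono divide_nonneg_nonneg max.cobounded2 mult_pos_pos zero_le_power2)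
      also have "\<dots> = max D 0 * K / \<theta> ^ (2 * m) / s ^ (2 * Suc m)"
        by (simp add: power_mult_distrib power2_eq_square mult_ac)
      finally show "T s \<le> max D 0 * K / \<theta> ^ (2 * m) / s ^ (2 * Suc m)" .
    qed (use K \<theta> in auto)
  qed
  then have poly: "\<exists>K\<ge>0. \<forall>s>0. T s \<le> K / s ^ (2 * m)" for m by blast
  have "integrable M (\<lambda>\<omega>. Y \<omega> ^ n)" if n: "n > 0" for n
  proof -
    obtain K where K: "K \<ge> 0" "\<And>s. s > 0 \<Longrightarrow> T s \<le> K / s ^ (2 * n)"
      using poly[of n] by blast
    define f where "f \<omega> = nat \<lceil>\<bar>Y \<omega>\<bar> ^ n\<rceil>" for \<omega>
    have f[measurable]: "f \<in> measurable M (count_space UNIV)"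
      unfolding f_def by measurable
    \<comment> \<open>the tail of order \<open>2 * n\<close> gives \<open>P(|Y| ^ n \<ge> t) = O(1 / t\<^sup>2)\<close>, which is summable\<close>
    define g where "g t = (if t = 0 then 1 else K / real t ^ 2)" for t :: nat
    have g: "emeasure M {\<omega> \<in> space M. t < f \<omega>} \<le> ennreal (g t)" for t
    proof (cases "t = 0")
      case True
      then show ?thesis using emeasure_le_1 by (simp add: g_def)
    next
      case False
      define s where "s = root n (real t)"
      have s: "s > 0" "s ^ n = real t" using False n by (simp_all add: s_def)
      have "s \<le> \<bar>Y \<omega>\<bar>" if "t < f \<omega>" for \<omega>
      proof -
        have "s ^ n \<le> \<bar>Y \<omega>\<bar> ^ n" using that unfolding s(2) f_def by linarith
        then show ?thesis using s(1) n by (simp add: power_mono_iff)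
      qed
      then have "emeasure M {\<omega> \<in> space M. t < f \<omega>} \<le> emeasure M {\<omega> \<in> space M. s \<le> \<bar>Y \<omega>\<bar>}"
        by (intro emeasure_mono) auto
      also have "\<dots> = ennreal (T s)" by (simp add: T_def emeasure_eq_measure)
      also have "\<dots> \<le> ennreal (K / s ^ (2 * n))" using K(2)[OF s(1)] by (rule ennreal_leI)
      also have "s ^ (2 * n) = real t ^ 2" by (simp add: s(2)[symmetric] power_mult[symmetric] mult.commute)
      finally show ?thesis using False by (simp add: g_def)
    qed
    have "summable (\<lambda>t. K * (1 / real (Suc t) ^ 2))"
      using inverse_power_summable[of 2, where 'a = real] summable_Suc_iff[of "\<lambda>t. inverse (real t ^ 2)"]
      by (intro summable_mult) (simp add: inverse_eq_divide)
    then have "summable (\<lambda>t. g (Suc t))" by (simp add: g_def)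
    then have "summable g" by (simp add: summable_Suc_iff)
    moreover have "g t \<ge> 0" for t using K(1) by (simp add: g_def)
    ultimately have fin: "(\<Sum>t. ennreal (g t)) < \<infinity>"
      by (simp add: suminf_ennreal2 less_top[symmetric])
    have "(\<integral>\<^sup>+\<omega>. ennreal (norm (Y \<omega> ^ n)) \<partial>M) \<le> (\<integral>\<^sup>+\<omega>. of_nat (f \<omega>) \<partial>M)"
      by (intro nn_integral_mono)
        (auto simp: f_def power_abs ennreal_of_nat_eq_real_of_nat intro!: ennreal_leI real_nat_ceiling_ge)
    also have "\<dots> = (\<Sum>t. emeasure M {\<omega> \<in> space M. t < f \<omega>})"
      by (rule nn_integral_nat_function) simp
    also have "\<dots> \<le> (\<Sum>t. ennreal (g t))"
      by (intro suminf_le g) auto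
    finally show ?thesis using fin by (intro integrableI_bounded) auto
  qed
  then have "integrable M (\<lambda>\<omega>. Y \<omega> ^ n)" for n
    by (cases "n = 0") auto
  then show ?thesis
    unfolding has_moments_def by simp
qed

lemma integrable_times_bounded:
  fixes Y Z :: "'a \<Rightarrow> real"
  assumes Y: "integrable M Y" and [measurable]: "Z \<in> borel_measurable M"
    and bounded: "\<And>\<omega>. \<bar>Z \<omega>\<bar> \<le> K"
  shows "integrable M (\<lambda>\<omega>. Y \<omega> * Z \<omega>)"
proof (rule Bochner_Integration.integrable_bound)
  show "integrable M (\<lambda>\<omega>. K * Y \<omega>)" using Y by simp
  have "\<bar>Y \<omega>\<bar> * \<bar>Z \<omega>\<bar> \<le> \<bar>Y \<omega>\<bar> * \<bar>K\<bar>" for \<omega>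
    using bounded[of \<omega>] by (intro mult_left_mono) auto
  then show "AE \<omega> in M. norm (Y \<omega> * Z \<omega>) \<le> norm (K * Y \<omega>)"
    by (simp add: abs_mult mult.commute)
qed (use Y in measurable)

section \<open>Consequences of the regression hypotheses\<close>

context quadratic_regression_sequence
begin

definition \<rho> :: real where "\<rho> = correlation M (X 0) (X 1)"

lemma X_measurable [measurable]: "X k \<in> borel_measurable M"
  using stationary by (simp add: L2_stationary_def)

lemma X_square_integrable: "integrable M (\<lambda>\<omega>. (X k \<omega>)\<^sup>2)"
  using stationary by (simp add: L2_stationary_def)

lemma X_times_integrable: "integrable M (\<lambda>\<omega>. X k \<omega> * X j \<omega>)"
  by (intro integrable_times_L2 X_square_integrable) auto

lemma X_integrable: "integrable M (X k)"
  using integrable_times_L2[of "X k" M "\<lambda>_. 1"] X_square_integrable by simp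

lemma covariance_shift:
  "expectation (\<lambda>\<omega>. X k \<omega> * X (k + j) \<omega>) = expectation (\<lambda>\<omega>. X 0 \<omega> * X j \<omega>)"
proof -
  have "\<forall>j k l. expectation (\<lambda>\<omega>. X k \<omega> * X (k + j) \<omega>) = expectation (\<lambda>\<omega>. X l \<omega> * X (l + j) \<omega>)"
    using stationary by (simp add: L2_stationary_def)
  from this[rule_format, of k j 0] show ?thesis by simp
qed

lemma correlation_eq: "correlation M (X k) (X (k + j)) = expectation (\<lambda>\<omega>. X 0 \<omega> * X j \<omega>)"
  unfolding correlation_def mean_zero using second_moment_one covariance_shift by simp

lemma space_sigma_others: "space (sigma_others M X k) = space M"
  by (simp add: sigma_others_def space_measure_of_conv)

lemma subalgebra_others: "subalgebra M (sigma_others M X k)"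
proof -
  have "{X j -` S \<inter> space M | j S. j \<noteq> k \<and> S \<in> sets borel} \<subseteq> sets M"
    by (auto intro!: measurable_sets[OF X_measurable])
  moreover then have "{X j -` S \<inter> space M | j S. j \<noteq> k \<and> S \<in> sets borel} \<subseteq> Pow (space M)"
    by (auto dest: sets.sets_into_space)
  ultimately show ?thesis
    unfolding subalgebra_def sigma_others_def by (auto intro!: sets.sigma_sets_subset)
qed

lemma sigma_finite_others: "sigma_finite_subalgebra M (sigma_others M X k)"
  by (intro finite_measure_subalgebra_is_sigma_finite finite_measure_subalgebra.intro
      finite_measure_subalgebra_axioms.intro subalgebra_others) unfold_locales

lemma X_measurable_others [measurable]:
  assumes "j \<noteq> k"
  shows "X j \<in> borel_measurable (sigma_others M X k)"
proof (rule measurableI)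
  fix S :: "real set" assume "S \<in> sets borel"
  then have "X j -` S \<inter> space M \<in> {X j -` S \<inter> space M | j S. j \<noteq> k \<and> S \<in> sets borel}"
    using assms by blast
  then show "X j -` S \<inter> space (sigma_others M X k) \<in> sets (sigma_others M X k)"
    unfolding space_sigma_others unfolding sigma_others_def
    by (subst sets_measure_of) (auto intro!: sigma_sets.Basic measurable_sets[OF X_measurable])
qed simp

text \<open>
  From here on the regressions are used only in integrated form, tested against functions of the
  remaining variables. Prediction from the past then reduces to recurrences for real numbers.
\<close>

lemma linear_regression_test:
  assumes Z: "Z \<in> borel_measurable (sigma_others M X k)"
    and int: "integrable M (\<lambda>\<omega>. Z \<omega> * X k \<omega>)"
  shows "expectation (\<lambda>\<omega>. Z \<omega> * X k \<omega>) = expectation (\<lambda>\<omega>. Z \<omega> * (a * (X (k - 1) \<omega> + X (k + 1) \<omega>) + b))"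
proof -
  interpret S: sigma_finite_subalgebra M "sigma_others M X k" by (rule sigma_finite_others)
  note [measurable] = measurable_from_subalg[OF subalgebra_others Z]
  have "expectation (\<lambda>\<omega>. Z \<omega> * X k \<omega>) = expectation (\<lambda>\<omega>. Z \<omega> * real_cond_exp M (sigma_others M X k) (X k) \<omega>)"
    by (rule S.real_cond_exp_intg(2)[symmetric, OF int Z]) simp
  also have "\<dots> = expectation (\<lambda>\<omega>. Z \<omega> * (a * (X (k - 1) \<omega> + X (k + 1) \<omega>) + b))"
    using linear_regression[of k] by (intro integral_cong_AE) (auto elim!: eventually_mono)
  finally show ?thesis .
qed

lemma quadratic_regression_test:
  assumes Z: "Z \<in> borel_measurable (sigma_others M X k)"
    and int: "integrable M (\<lambda>\<omega>. Z \<omega> * (X k \<omega>)\<^sup>2)"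
  shows "expectation (\<lambda>\<omega>. Z \<omega> * (X k \<omega>)\<^sup>2) = expectation (\<lambda>\<omega>. Z \<omega> *
     (A * ((X (k - 1) \<omega>)\<^sup>2 + (X (k + 1) \<omega>)\<^sup>2) + B * X (k - 1) \<omega> * X (k + 1) \<omega> + C))"
proof -
  interpret S: sigma_finite_subalgebra M "sigma_others M X k" by (rule sigma_finite_others)
  note [measurable] = measurable_from_subalg[OF subalgebra_others Z]
  have "expectation (\<lambda>\<omega>. Z \<omega> * (X k \<omega>)\<^sup>2) = expectation (\<lambda>\<omega>. Z \<omega> * real_cond_exp M (sigma_others M X k) (\<lambda>\<omega>. (X k \<omega>)\<^sup>2) \<omega>)"
    by (rule S.real_cond_exp_intg(2)[symmetric, OF int Z]) simp
  also have "\<dots> = expectation (\<lambda>\<omega>. Z \<omega> *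
     (A * ((X (k - 1) \<omega>)\<^sup>2 + (X (k + 1) \<omega>)\<^sup>2) + B * X (k - 1) \<omega> * X (k + 1) \<omega> + C))"
    using quadratic_regression[of k] by (intro integral_cong_AE) (auto elim!: eventually_mono)
  finally show ?thesis .
qed

lemma b_eq_0: "b = 0"
  using linear_regression_test[of "\<lambda>_. 1" 0] X_integrable mean_zero
  by (simp add: prob_space)

lemma linear_regression_test':
  assumes Z: "Z \<in> borel_measurable (sigma_others M X k)"
    and int: "integrable M (\<lambda>\<omega>. X k \<omega> * Z \<omega>)" "integrable M (\<lambda>\<omega>. X (k - 1) \<omega> * Z \<omega>)" "integrable M (\<lambda>\<omega>. X (k + 1) \<omega> * Z \<omega>)"
  shows "expectation (\<lambda>\<omega>. X k \<omega> * Z \<omega>) =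
     a * (expectation (\<lambda>\<omega>. X (k - 1) \<omega> * Z \<omega>) + expectation (\<lambda>\<omega>. X (k + 1) \<omega> * Z \<omega>))"
proof -
  have "expectation (\<lambda>\<omega>. Z \<omega> * X k \<omega>) = expectation (\<lambda>\<omega>. a * (X (k - 1) \<omega> * Z \<omega> + X (k + 1) \<omega> * Z \<omega>))"
    using linear_regression_test[OF Z] int(1) b_eq_0 by (simp add: algebra_simps)
  then show ?thesis using int by (simp add: mult.commute)
qed

lemma quadratic_regression_test':
  assumes Z: "Z \<in> borel_measurable (sigma_others M X k)"
    and int: "integrable M (\<lambda>\<omega>. (X k \<omega>)\<^sup>2 * Z \<omega>)" "integrable M (\<lambda>\<omega>. (X (k - 1) \<omega>)\<^sup>2 * Z \<omega>)"
      "integrable M (\<lambda>\<omega>. (X (k + 1) \<omega>)\<^sup>2 * Z \<omega>)" "integrable M (\<lambda>\<omega>. X (k + 1) \<omega> * (X (k - 1) \<omega> * Z \<omega>))"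
      "integrable M Z"
  shows "expectation (\<lambda>\<omega>. (X k \<omega>)\<^sup>2 * Z \<omega>) =
     A * (expectation (\<lambda>\<omega>. (X (k - 1) \<omega>)\<^sup>2 * Z \<omega>) + expectation (\<lambda>\<omega>. (X (k + 1) \<omega>)\<^sup>2 * Z \<omega>))
     + B * expectation (\<lambda>\<omega>. X (k + 1) \<omega> * (X (k - 1) \<omega> * Z \<omega>)) + C * expectation Z"
proof -
  have "expectation (\<lambda>\<omega>. Z \<omega> * (X k \<omega>)\<^sup>2) =
     expectation (\<lambda>\<omega>. A * ((X (k - 1) \<omega>)\<^sup>2 * Z \<omega> + (X (k + 1) \<omega>)\<^sup>2 * Z \<omega>)
       + B * (X (k + 1) \<omega> * (X (k - 1) \<omega> * Z \<omega>)) + C * Z \<omega>)"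
    using quadratic_regression_test[OF Z] int(1) by (simp add: algebra_simps)
  then show ?thesis using int by (simp add: mult.commute)
qed

lemma abs_covariance_le:
  assumes [measurable]: "Z \<in> borel_measurable M" and Z: "integrable M (\<lambda>\<omega>. (Z \<omega>)\<^sup>2)"
  shows "\<bar>expectation (\<lambda>\<omega>. X k \<omega> * Z \<omega>)\<bar> \<le> 1 + expectation (\<lambda>\<omega>. (Z \<omega>)\<^sup>2)"
proof -
  have "\<bar>x * y\<bar> \<le> x\<^sup>2 + y\<^sup>2" for x y :: real
    using sum_squares_bound[of x y] sum_squares_bound[of x "- y"]
      sum_power2_ge_zero[of x y] by (simp add: abs_le_iff)
  then have "expectation (\<lambda>\<omega>. \<bar>X k \<omega> * Z \<omega>\<bar>) \<le> expectation (\<lambda>\<omega>. (X k \<omega>)\<^sup>2 + (Z \<omega>)\<^sup>2)"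
    using X_square_integrable Z integrable_times_L2[of "X k" M Z]
    by (intro integral_mono) auto
  also have "\<dots> = 1 + expectation (\<lambda>\<omega>. (Z \<omega>)\<^sup>2)"
    using X_square_integrable Z second_moment_one by simp
  finally show ?thesis
    using integral_norm_bound[of M "\<lambda>\<omega>. X k \<omega> * Z \<omega>", unfolded real_norm_def]
    by (rule order_trans[rotated])
qed

text \<open>
  The correlations \<open>r j\<close> satisfy \<open>r j = a * (r (j - 1) + r (j + 1))\<close> for \<open>j \<noteq> 0\<close> and are bounded;
  the hypothesis on \<open>r 2\<close> makes the characteristic roots real and distinct, so boundedness selects the
  root inside the unit interval.
\<close>

lemma rho_nonzero: "\<rho> \<noteq> 0" and abs_rho_less_1: "\<bar>\<rho>\<bar> < 1" and a_eq: "a * (1 + \<rho>\<^sup>2) = \<rho>"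
proof -
  define r where "r j = expectation (\<lambda>\<omega>. X j \<omega> * X 0 \<omega>)" for j :: int
  have corr: "correlation M (X 0) (X j) = r j" for j
    using correlation_eq[of 0 j] by (simp add: r_def mult.commute)
  have rec: "r j = a * (r (j - 1) + r (j + 1))" if "j \<noteq> 0" for j
    unfolding r_def using that
    by (intro linear_regression_test' X_measurable_others X_times_integrable) auto
  have r0: "r 0 = 1" using second_moment_one[of 0] by (simp add: r_def power2_eq_square)
  show nz: "\<rho> \<noteq> 0" using corr_1_nonzero by (simp add: \<rho>_def)
  have a: "\<rho> = a * (1 + r 2)" using rec[of 1] r0 by (simp add: \<rho>_def corr)
  then have "a \<noteq> 0" using nz by auto
  have gap: "2 * \<bar>\<rho>\<bar> < r 2 + 1" using corr_2_bound by (simp add: \<rho>_def corr)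
  then have pos: "1 + r 2 > 0" using abs_ge_zero[of \<rho>] by linarith
  have "\<bar>a\<bar> < 1 / 2"
  proof (rule ccontr)
    assume "\<not> \<bar>a\<bar> < 1 / 2"
    then have "1 / 2 * (1 + r 2) \<le> \<bar>a\<bar> * (1 + r 2)"
      using pos by (intro mult_right_mono) auto
    also have "\<dots> = \<bar>\<rho>\<bar>" using pos unfolding a abs_mult by simp
    finally show False using gap by simp
  qed
  then obtain s where l: "s \<noteq> 0" "\<bar>s\<bar> < 1" "a * (1 + s\<^sup>2) = s"
    using reciprocal_pair \<open>a \<noteq> 0\<close> by blast
  have "r (int n) = s ^ n * r (int 0)" for n
  proof (rule bounded_recurrence_geometric[OF l(1,2)])
    show "(1 + s\<^sup>2) * r (int (Suc n)) = s * (r (int n) + r (int (Suc (Suc n))))" for n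
    proof -
      have "r (int (Suc n)) = a * (r (int n) + r (int (Suc (Suc n))))"
        using rec[of "int (Suc n)"] by (simp add: add.commute)
      then have "(1 + s\<^sup>2) * r (int (Suc n)) = a * (1 + s\<^sup>2) * (r (int n) + r (int (Suc (Suc n))))"
        by simp
      then show ?thesis unfolding l(3) .
    qed
    show "\<bar>r (int n)\<bar> \<le> 1 + 1" for n
      unfolding r_def using abs_covariance_le[of "X 0"] X_square_integrable second_moment_one by simp
  qed
  from this[of 1] have "\<rho> = s" using r0 by (simp add: \<rho>_def corr)
  then show "\<bar>\<rho>\<bar> < 1" "a * (1 + \<rho>\<^sup>2) = \<rho>" using l by auto
qed

text \<open>
  Measurability with respect to \<open>sigma_others M X j\<close> for all \<open>j > k\<close> serves as a substitute for
  measurability with respect to the past \<open>\<sigma>(X i, i \<le> k)\<close>: it is what testing the regressions at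
  the sites \<open>j > k\<close> requires.
\<close>

definition past :: "int \<Rightarrow> ('a \<Rightarrow> real) \<Rightarrow> bool" where
  "past k Z \<longleftrightarrow> (\<forall>j>k. Z \<in> borel_measurable (sigma_others M X j))"

lemma pastD: "past k Z \<Longrightarrow> k < j \<Longrightarrow> Z \<in> borel_measurable (sigma_others M X j)"
  by (simp add: past_def)

lemma past_measurable: "past k Z \<Longrightarrow> Z \<in> borel_measurable M"
  using measurable_from_subalg[OF subalgebra_others] pastD[of k Z "k + 1"] by simp

lemma past_mono: "past k Z \<Longrightarrow> k \<le> j \<Longrightarrow> past j Z"
  by (simp add: past_def)

lemma past_X: "j \<le> k \<Longrightarrow> past k (X j)"
  by (auto simp: past_def intro: X_measurable_others)

lemma past_const: "past k (\<lambda>_. c)"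
  by (simp add: past_def)

lemma past_mult: "past k Y \<Longrightarrow> past k Z \<Longrightarrow> past k (\<lambda>\<omega>. Y \<omega> * Z \<omega>)"
  by (simp add: past_def borel_measurable_times)

lemma past_comp: "past k Z \<Longrightarrow> f \<in> borel_measurable borel \<Longrightarrow> past k (\<lambda>\<omega>. f (Z \<omega>))"
  by (auto simp: past_def intro: measurable_compose)

text \<open>
  For fixed \<open>Z\<close> the numbers \<open>E (X (k + n) * Z)\<close> satisfy the recurrence of the correlations and
  are bounded.
\<close>

lemma linear_prediction:
  assumes Z: "past k Z" "integrable M (\<lambda>\<omega>. (Z \<omega>)\<^sup>2)"
  shows "expectation (\<lambda>\<omega>. X (k + int n) \<omega> * Z \<omega>) = \<rho> ^ n * expectation (\<lambda>\<omega>. X k \<omega> * Z \<omega>)"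
proof -
  define u where "u n = expectation (\<lambda>\<omega>. X (k + int n) \<omega> * Z \<omega>)" for n
  note [measurable] = past_measurable[OF Z(1)]
  have int: "integrable M (\<lambda>\<omega>. X j \<omega> * Z \<omega>)" for j
    by (intro integrable_times_L2 X_square_integrable Z) auto
  have "u n = \<rho> ^ n * u 0"
  proof (rule bounded_recurrence_geometric[OF rho_nonzero abs_rho_less_1])
    show "\<bar>u n\<bar> \<le> 1 + expectation (\<lambda>\<omega>. (Z \<omega>)\<^sup>2)" for n
      unfolding u_def by (intro abs_covariance_le Z) simp
    show "(1 + \<rho>\<^sup>2) * u (Suc n) = \<rho> * (u n + u (Suc (Suc n)))" for n
    proof -
      have "u (Suc n) = a * (u n + u (Suc (Suc n)))"
        using linear_regression_test'[OF pastD[OF Z(1), of "k + int (Suc n)"] int int int]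
        by (simp add: u_def add_ac)
      then have "(1 + \<rho>\<^sup>2) * u (Suc n) = a * (1 + \<rho>\<^sup>2) * (u n + u (Suc (Suc n)))"
        by simp
      then show ?thesis unfolding a_eq .
    qed
  qed
  then show ?thesis by (simp add: u_def)
qed

lemma linear_prediction_1:
  assumes "past k Z" "integrable M (\<lambda>\<omega>. (Z \<omega>)\<^sup>2)"
  shows "expectation (\<lambda>\<omega>. X (k + 1) \<omega> * Z \<omega>) = \<rho> * expectation (\<lambda>\<omega>. X k \<omega> * Z \<omega>)"
  using linear_prediction[OF assms, of 1] by simp

lemma linear_prediction_2:
  assumes "past k Z" "integrable M (\<lambda>\<omega>. (Z \<omega>)\<^sup>2)"
  shows "expectation (\<lambda>\<omega>. X (k + 2) \<omega> * Z \<omega>) = \<rho>\<^sup>2 * expectation (\<lambda>\<omega>. X k \<omega> * Z \<omega>)"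
  using linear_prediction[OF assms, of 2] by simp

lemma coefficients_rho: "A * (\<rho>\<^sup>2 + 1 / \<rho>\<^sup>2) + B = 1"
  using coefficients by (simp add: \<rho>_def)

lemma covariance_2: "expectation (\<lambda>\<omega>. X (k + 1) \<omega> * X (k - 1) \<omega>) = \<rho>\<^sup>2"
  using linear_prediction_2[OF past_X[of "k - 1" "k - 1"] X_square_integrable] second_moment_one
  by (simp add: power2_eq_square add.commute)

lemma C_eq: "C = 1 - 2 * A - B * \<rho>\<^sup>2"
proof -
  have "expectation (\<lambda>\<omega>. (X 0 \<omega>)\<^sup>2 * 1) =
     A * (expectation (\<lambda>\<omega>. (X (0 - 1) \<omega>)\<^sup>2 * 1) + expectation (\<lambda>\<omega>. (X (0 + 1) \<omega>)\<^sup>2 * 1))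
     + B * expectation (\<lambda>\<omega>. X (0 + 1) \<omega> * (X (0 - 1) \<omega> * 1)) + C * expectation (\<lambda>_. 1)"
    by (rule quadratic_regression_test') (simp_all add: X_square_integrable X_times_integrable)
  then show ?thesis
    unfolding mult_1_right second_moment_one covariance_2 by (simp add: prob_space)
qed

lemma B_times_square: "B * \<rho>\<^sup>2 = \<rho>\<^sup>2 - A * (\<rho>\<^sup>2 * \<rho>\<^sup>2 + 1)"
proof -
  have "A * (t * t + 1) + B * t = (A * (t + 1 / t) + B) * t" if "t \<noteq> 0" for t
    using that by (simp add: distrib_left distrib_right)
  from this[of "\<rho>\<^sup>2"] show ?thesis
    using rho_nonzero unfolding coefficients_rho by simp
qed

lemma C_factor: "C = (1 - \<rho>\<^sup>2) * (1 - A * (1 + \<rho>\<^sup>2))"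
proof -
  show ?thesis
    unfolding C_eq B_times_square by (simp add: algebra_simps)
qed

end

text \<open>
  The degenerate case \<open>A * (1 + \<rho>\<^sup>2) = 1\<close>, in which the quadratic regression of
  second moments repeats what the linear regression says, forces \<open>B < 0\<close> and hence \<open>R < 0\<close>. All assertions concern \<open>R \<ge> 0\<close>.
\<close>

locale nonneg_quadratic_regression = quadratic_regression_sequence +
  assumes B_nonneg: "B \<ge> 0"
begin

lemma nondegenerate: "1 - A * (1 + \<rho>\<^sup>2) \<noteq> 0"
proof
  assume "1 - A * (1 + \<rho>\<^sup>2) = 0"
  then have A: "A * (1 + \<rho>\<^sup>2) = 1" by simp
  have r: "0 < \<rho>\<^sup>2" "\<rho>\<^sup>2 < 1" using rho_nonzero abs_rho_less_1 by (auto simp: abs_square_less_1)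
  define S where "S = \<rho>\<^sup>2 + 1 / \<rho>\<^sup>2"
  have "1 = (1 + \<rho>\<^sup>2) * (A * S + B) - \<rho>\<^sup>2"
    unfolding S_def coefficients_rho by simp
  also have "\<dots> = A * (1 + \<rho>\<^sup>2) * S + (1 + \<rho>\<^sup>2) * B - \<rho>\<^sup>2"
    by (simp add: algebra_simps)
  also have "\<dots> = 1 / \<rho>\<^sup>2 + (1 + \<rho>\<^sup>2) * B" unfolding A by (simp add: S_def)
  finally have "1 = 1 / \<rho>\<^sup>2 + (1 + \<rho>\<^sup>2) * B" .
  moreover have "1 / \<rho>\<^sup>2 > 1" using r by simp
  moreover have "(1 + \<rho>\<^sup>2) * B \<ge> 0" using B_nonneg by simp
  ultimately show False by linarith
qed

text \<open>
  The mixed moment of \<open>X (k + 1)\<close>, \<open>X (k + 2)\<close> and \<open>Z\<close> can be evaluated by predicting \<open>X (k + 2)\<close>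
  from the past or by the linear regression of \<open>X (k + 1)\<close> on its two neighbours. The two values
  give one linear relation between the second moments at \<open>k\<close>, \<open>k + 1\<close>, \<open>k + 2\<close>; the quadratic
  regression gives another.
\<close>

lemma quadratic_prediction:
  assumes Z: "past k Z" and bounded: "\<And>\<omega>. \<bar>Z \<omega>\<bar> \<le> K"
  shows "expectation (\<lambda>\<omega>. (X (k + 1) \<omega>)\<^sup>2 * Z \<omega>) =
     \<rho>\<^sup>2 * expectation (\<lambda>\<omega>. (X k \<omega>)\<^sup>2 * Z \<omega>) + (1 - \<rho>\<^sup>2) * expectation Z"
proof -
  note [measurable] = past_measurable[OF Z]
  note bound = integrable_times_bounded[OF _ past_measurable[OF Z] bounded]
  have L2: "integrable M (\<lambda>\<omega>. (X j \<omega> * Z \<omega>)\<^sup>2)" for j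
    using bound[OF bound[OF X_square_integrable[of j]]] by (simp add: power2_eq_square mult_ac)
  have int1: "integrable M (\<lambda>\<omega>. (X j \<omega>)\<^sup>2 * Z \<omega>)" for j
    by (intro bound X_square_integrable)
  have int2: "integrable M (\<lambda>\<omega>. X i \<omega> * (X j \<omega> * Z \<omega>))" for i j
    using bound[OF X_times_integrable[of i j]] by (simp add: mult_ac)
  have int3: "integrable M Z" using bound[of "\<lambda>_. 1"] by simp
  define v where "v i = expectation (\<lambda>\<omega>. (X (k + i) \<omega>)\<^sup>2 * Z \<omega>)" for i
  have sq: "expectation (\<lambda>\<omega>. X (k + i) \<omega> * (X (k + i) \<omega> * Z \<omega>)) = v i" for i
    by (simp add: v_def power2_eq_square mult.assoc)
  have p0: "past k (\<lambda>\<omega>. X k \<omega> * Z \<omega>)" and p1: "past (k + 1) (\<lambda>\<omega>. X (k + 1) \<omega> * Z \<omega>)"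
    using Z by (auto intro!: past_mult past_X elim: past_mono)
  have cross: "expectation (\<lambda>\<omega>. X (k + 2) \<omega> * (X k \<omega> * Z \<omega>)) = \<rho>\<^sup>2 * v 0"
    using linear_prediction_2[OF p0 L2] sq[of 0] by simp
  have "expectation (\<lambda>\<omega>. X (k + 2) \<omega> * (X (k + 1) \<omega> * Z \<omega>)) = \<rho> * v 1"
    using linear_prediction_1[OF p1 L2] sq[of 1] by (simp add: add.commute)
  moreover have "expectation (\<lambda>\<omega>. X (k + 1) \<omega> * (X (k + 2) \<omega> * Z \<omega>)) =
     a * (expectation (\<lambda>\<omega>. X k \<omega> * (X (k + 2) \<omega> * Z \<omega>)) + v 2)"
  proof -
    have "(\<lambda>\<omega>. X (k + 2) \<omega> * Z \<omega>) \<in> borel_measurable (sigma_others M X (k + 1))"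
      using pastD[OF Z, of "k + 1"] X_measurable_others[of "k + 2" "k + 1"] by simp
    from linear_regression_test'[OF this int2 int2 int2] sq[of 2] show ?thesis
      by (simp add: add.commute)
  qed
  ultimately have "\<rho> * v 1 = a * (\<rho>\<^sup>2 * v 0 + v 2)"
    using cross by (simp add: mult.left_commute)
  then have "(1 + \<rho>\<^sup>2) * (\<rho> * v 1) = (a * (1 + \<rho>\<^sup>2)) * (\<rho>\<^sup>2 * v 0 + v 2)" by simp
  then have v2: "v 2 = (1 + \<rho>\<^sup>2) * v 1 - \<rho>\<^sup>2 * v 0"
    using rho_nonzero unfolding a_eq by (simp add: mult.left_commute)
  have "v 1 = A * (v 0 + v 2) + B * (\<rho>\<^sup>2 * v 0) + C * expectation Z"
    using quadratic_regression_test'[OF pastD[OF Z, of "k + 1"] int1 int1 int1 int2 int3] cross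
    by (simp add: v_def add.commute)
  then have v1: "(1 - A * (1 + \<rho>\<^sup>2)) * v 1 = (A - A * \<rho>\<^sup>2 + B * \<rho>\<^sup>2) * v 0 + C * expectation Z"
    unfolding v2 by (simp add: algebra_simps)
  have v0: "A - A * \<rho>\<^sup>2 + B * \<rho>\<^sup>2 = \<rho>\<^sup>2 * (1 - A * (1 + \<rho>\<^sup>2))"
    unfolding B_times_square by (simp add: algebra_simps)
  have "(1 - A * (1 + \<rho>\<^sup>2)) * v 1 =
     (1 - A * (1 + \<rho>\<^sup>2)) * (\<rho>\<^sup>2 * v 0 + (1 - \<rho>\<^sup>2) * expectation Z)"
    unfolding v1 v0 C_factor by (simp only: distrib_left mult_ac)
  then show ?thesis using nondegenerate by (simp add: v_def)
qed

lemma conditional_variance: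
  assumes Z: "past k Z" and bounded: "\<And>\<omega>. \<bar>Z \<omega>\<bar> \<le> K"
  shows "integrable M (\<lambda>\<omega>. (X (k + 1) \<omega> - \<rho> * X k \<omega>)\<^sup>2 * Z \<omega>)"
    and "expectation (\<lambda>\<omega>. (X (k + 1) \<omega> - \<rho> * X k \<omega>)\<^sup>2 * Z \<omega>) = (1 - \<rho>\<^sup>2) * expectation Z"
proof -
  note [measurable] = past_measurable[OF Z]
  note bound = integrable_times_bounded[OF _ past_measurable[OF Z] bounded]
  have int: "integrable M (\<lambda>\<omega>. (X (k + 1) \<omega>)\<^sup>2 * Z \<omega>)" "integrable M (\<lambda>\<omega>. (X k \<omega>)\<^sup>2 * Z \<omega>)"
    "integrable M (\<lambda>\<omega>. X (k + 1) \<omega> * (X k \<omega> * Z \<omega>))"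
    using bound[OF X_square_integrable] bound[OF X_times_integrable[of "k + 1" k]]
    by (simp_all add: mult.assoc)
  have L2: "integrable M (\<lambda>\<omega>. (X k \<omega> * Z \<omega>)\<^sup>2)"
    using bound[OF bound[OF X_square_integrable[of k]]] by (simp add: power2_eq_square mult_ac)
  have cross: "expectation (\<lambda>\<omega>. X (k + 1) \<omega> * (X k \<omega> * Z \<omega>)) = \<rho> * expectation (\<lambda>\<omega>. (X k \<omega>)\<^sup>2 * Z \<omega>)"
    using linear_prediction_1[OF past_mult[OF past_X[OF order_refl] Z] L2]
    by (simp add: power2_eq_square mult.assoc)
  have eq: "(X (k + 1) \<omega> - \<rho> * X k \<omega>)\<^sup>2 * Z \<omega> = (X (k + 1) \<omega>)\<^sup>2 * Z \<omega>
      - 2 * \<rho> * (X (k + 1) \<omega> * (X k \<omega> * Z \<omega>)) + \<rho>\<^sup>2 * ((X k \<omega>)\<^sup>2 * Z \<omega>)" for \<omega>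
    by (simp add: power2_eq_square algebra_simps)
  show "integrable M (\<lambda>\<omega>. (X (k + 1) \<omega> - \<rho> * X k \<omega>)\<^sup>2 * Z \<omega>)"
    unfolding eq using int by simp
  show "expectation (\<lambda>\<omega>. (X (k + 1) \<omega> - \<rho> * X k \<omega>)\<^sup>2 * Z \<omega>) = (1 - \<rho>\<^sup>2) * expectation Z"
  proof -
    have "expectation (\<lambda>\<omega>. (X (k + 1) \<omega> - \<rho> * X k \<omega>)\<^sup>2 * Z \<omega>) = expectation (\<lambda>\<omega>. (X (k + 1) \<omega>)\<^sup>2 * Z \<omega>)
        - 2 * \<rho> * expectation (\<lambda>\<omega>. X (k + 1) \<omega> * (X k \<omega> * Z \<omega>)) + \<rho>\<^sup>2 * expectation (\<lambda>\<omega>. (X k \<omega>)\<^sup>2 * Z \<omega>)"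
      unfolding eq using int by simp
    then show ?thesis
      unfolding quadratic_prediction[OF Z bounded] cross by (simp add: power2_eq_square)
  qed
qed

section \<open>Finiteness of all moments\<close>

definition tail :: "real \<Rightarrow> real" where
  "tail s = prob {\<omega> \<in> space M. s \<le> \<bar>X 0 \<omega>\<bar>}"

lemma tail_eq: "prob {\<omega> \<in> space M. s \<le> \<bar>X k \<omega>\<bar>} = tail s"
proof -
  have "prob {\<omega> \<in> space M. s \<le> \<bar>X j \<omega>\<bar>} = measure (distr M borel (X j)) {x. s \<le> \<bar>x\<bar>}" for j
    by (subst measure_distr) (auto intro!: arg_cong[where f = prob])
  then show ?thesis using same_distribution[of k] by (simp add: tail_def)
qed

lemma tail_antimono: "s \<le> t \<Longrightarrow> tail t \<le> tail s"
  unfolding tail_def by (intro finite_measure_mono) auto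

lemma tail_nonneg: "0 \<le> tail s"
  by (simp add: tail_def)

lemma conditional_chebyshev:
  assumes t: "t > 0"
  shows "prob {\<omega> \<in> space M. s \<le> \<bar>X k \<omega>\<bar> \<and> t \<le> \<bar>X (k + 1) \<omega> - \<rho> * X k \<omega>\<bar>} \<le> (1 - \<rho>\<^sup>2) / t\<^sup>2 * tail s"
proof -
  let ?E = "{\<omega> \<in> space M. s \<le> \<bar>X k \<omega>\<bar> \<and> t \<le> \<bar>X (k + 1) \<omega> - \<rho> * X k \<omega>\<bar>}"
  define Z where "Z \<omega> = indicat_real {x. s \<le> \<bar>x\<bar>} (X k \<omega>)" for \<omega>
  have Z: "past k Z" unfolding Z_def by (intro past_comp[OF past_X]) auto
  have bounded: "\<bar>Z \<omega>\<bar> \<le> 1" for \<omega> by (simp add: Z_def indicator_def)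
  have "t\<^sup>2 * prob ?E = expectation (\<lambda>\<omega>. t\<^sup>2 * indicator ?E \<omega>)" by simp
  also have "\<dots> \<le> expectation (\<lambda>\<omega>. (X (k + 1) \<omega> - \<rho> * X k \<omega>)\<^sup>2 * Z \<omega>)"
  proof (rule integral_mono[OF _ conditional_variance(1)[OF Z bounded]])
    show "integrable M (\<lambda>\<omega>. t\<^sup>2 * indicator ?E \<omega>)"
      by (intro integrable_mult_right integrable_real_indicator) (auto simp: emeasure_eq_measure)
    show "t\<^sup>2 * indicator ?E \<omega> \<le> (X (k + 1) \<omega> - \<rho> * X k \<omega>)\<^sup>2 * Z \<omega>" for \<omega>
      using t abs_le_square_iff[of t "X (k + 1) \<omega> - \<rho> * X k \<omega>"] by (auto simp: indicator_def Z_def)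
  qed
  also have "\<dots> = (1 - \<rho>\<^sup>2) * expectation Z"
    by (rule conditional_variance(2)[OF Z bounded])
  also have "expectation Z = expectation (indicator {\<omega> \<in> space M. s \<le> \<bar>X k \<omega>\<bar>})"
    by (intro Bochner_Integration.integral_cong) (auto simp: Z_def indicator_def)
  also have "\<dots> = tail s" using tail_eq[of s k] by simp
  finally show ?thesis using t by (simp add: field_simps)
qed

end

text \<open>
  The hypotheses are invariant under time reversal, so the future can be used to predict the past.
\<close>

lemma (in quadratic_regression_sequence) sigma_others_reversed:
  "sigma_others M (\<lambda>k. X (- k)) k = sigma_others M X (- k)"
proof -
  have "{X (- j) -` S \<inter> space M | j S. j \<noteq> k \<and> S \<in> sets borel} =
      {X j -` S \<inter> space M | j S. j \<noteq> - k \<and> S \<in> sets borel}" (is "?L = ?R")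
  proof (intro subset_antisym subsetI)
    fix Y assume "Y \<in> ?L"
    then obtain j S where "Y = X (- j) -` S \<inter> space M" "- j \<noteq> - k" "S \<in> sets borel" by auto
    then show "Y \<in> ?R" by blast
  next
    fix Y assume "Y \<in> ?R"
    then obtain j S where "Y = X (- (- j)) -` S \<inter> space M" "- j \<noteq> k" "S \<in> sets borel" by auto
    then show "Y \<in> ?L" by blast
  qed
  then show ?thesis by (simp add: sigma_others_def)
qed

lemma (in quadratic_regression_sequence) correlation_reversed:
  "correlation M (X 0) (X (- j)) = correlation M (X 0) (X j)"
  using correlation_eq[of 0 j] correlation_eq[of 0 "- j"] covariance_shift[of "- j" j] by (simp add: mult.commute)

lemma (in nonneg_quadratic_regression) reversed:
  "nonneg_quadratic_regression M (\<lambda>k. X (- k)) a b A B C"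
proof
  show "L2_stationary M (\<lambda>k. X (- k))"
    unfolding L2_stationary_def
  proof (intro conjI allI)
    show "expectation (\<lambda>\<omega>. X (- k) \<omega> * X (- (k + j)) \<omega>) = expectation (\<lambda>\<omega>. X (- l) \<omega> * X (- (l + j)) \<omega>)" for j k l
      using covariance_shift[of "- k" "- j"] covariance_shift[of "- l" "- j"] by simp
  qed (simp_all add: X_square_integrable mean_zero)
  show "expectation (X (- k)) = 0" for k by (rule mean_zero)
  show "expectation (\<lambda>\<omega>. (X (- k) \<omega>)\<^sup>2) = 1" for k by (rule second_moment_one)
  show "distr M borel (X (- k)) = distr M borel (X (- 0))" for k
    using same_distribution[of "- k"] by simp
  show "correlation M (X (- 0)) (X (- 1)) \<noteq> 0"
    using corr_1_nonzero correlation_reversed[of 1] by simp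
  show "correlation M (X (- 0)) (X (- 2)) + 1 - 2 * \<bar>correlation M (X (- 0)) (X (- 1))\<bar> > 0"
    using corr_2_bound correlation_reversed[of 1] correlation_reversed[of 2] by simp
  show "A * ((correlation M (X (- 0)) (X (- 1)))\<^sup>2 + 1 / (correlation M (X (- 0)) (X (- 1)))\<^sup>2) + B = 1"
    using coefficients correlation_reversed[of 1] by simp
  have neg: "- (k - 1) = - k + 1" "- (k + 1) = - k - 1" for k :: int by simp_all
  show "AE \<omega> in M. real_cond_exp M (sigma_others M (\<lambda>k. X (- k)) k) (X (- k)) \<omega> =
       a * (X (- (k - 1)) \<omega> + X (- (k + 1)) \<omega>) + b" for k
    unfolding sigma_others_reversed neg using linear_regression[of "- k"]
    by (simp only: add.commute[of "X (- k + 1) _"])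
  show "AE \<omega> in M. real_cond_exp M (sigma_others M (\<lambda>k. X (- k)) k) (\<lambda>\<omega>. (X (- k) \<omega>)\<^sup>2) \<omega> =
       A * ((X (- (k - 1)) \<omega>)\<^sup>2 + (X (- (k + 1)) \<omega>)\<^sup>2) + B * X (- (k - 1)) \<omega> * X (- (k + 1)) \<omega> + C" for k
    unfolding sigma_others_reversed neg using quadratic_regression[of "- k"]
    by (simp only: add.commute[of "(X (- k + 1) _)\<^sup>2"] mult.assoc mult.commute[of "X (- k + 1) _"])
qed (rule B_nonneg)

context nonneg_quadratic_regression
begin

lemma conditional_chebyshev_backward:
  assumes t: "t > 0"
  shows "prob {\<omega> \<in> space M. s \<le> \<bar>X (k + 1) \<omega>\<bar> \<and> t \<le> \<bar>X k \<omega> - \<rho> * X (k + 1) \<omega>\<bar>} \<le> (1 - \<rho>\<^sup>2) / t\<^sup>2 * tail s"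
proof -
  interpret R: nonneg_quadratic_regression M "\<lambda>k. X (- k)" a b A B C by (rule reversed)
  have "R.\<rho> = \<rho>" "R.tail s = tail s"
    using correlation_reversed[of 1] by (simp_all add: \<rho>_def R.\<rho>_def tail_def R.tail_def)
  then show ?thesis using R.conditional_chebyshev[OF t, of s "- k - 1"] by (simp add: add.commute)
qed

text \<open>
  Suppose \<open>|X 0| \<ge> s\<close>. If \<open>|X 1| < |\<rho>| * s / 2\<close>, then \<open>X 1\<close> is far from \<open>\<rho> * X 0\<close>; if
  \<open>|X 1|\<close> lies between \<open>|\<rho>| * s / 2\<close> and \<open>s\<close>, then \<open>X 0\<close> is far from \<open>\<rho> * X 1\<close>; if
  \<open>|X 1| \<ge> s\<close>, then again \<open>X 1\<close> is far from \<open>\<rho> * X 0\<close> unless \<open>|X 0|\<close> exceeds \<open>s\<close> by a fixed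
  factor greater than \<open>1\<close>. Each deviation has conditional probability \<open>O(1 / s\<^sup>2)\<close>.
\<close>

lemma tail_step:
  fixes s
  assumes s: "s > 0"
  shows "tail s \<le> (1 - \<rho>\<^sup>2) * (4 / \<rho>\<^sup>2 + 5 / (1 - \<bar>\<rho>\<bar>)\<^sup>2) / s\<^sup>2 * tail (\<bar>\<rho>\<bar> / 2 * s)
    + tail ((1 + \<bar>\<rho>\<bar>) / (2 * \<bar>\<rho>\<bar>) * s)"
proof -
  define d where "d = 1 - \<bar>\<rho>\<bar>"
  have d: "d > 0" using abs_rho_less_1 by (simp add: d_def)
  have r: "\<bar>\<rho>\<bar> > 0" using rho_nonzero by simp
  have v: "1 - \<rho>\<^sup>2 \<ge> 0" using abs_rho_less_1 by (simp add: abs_square_le_1)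
  let ?F = "\<lambda>t. {\<omega> \<in> space M. s \<le> \<bar>X 0 \<omega>\<bar> \<and> t \<le> \<bar>X (0 + 1) \<omega> - \<rho> * X 0 \<omega>\<bar>}"
  let ?B = "{\<omega> \<in> space M. \<bar>\<rho>\<bar> / 2 * s \<le> \<bar>X (0 + 1) \<omega>\<bar> \<and> d * s \<le> \<bar>X 0 \<omega> - \<rho> * X (0 + 1) \<omega>\<bar>}"
  let ?T = "{\<omega> \<in> space M. (1 + \<bar>\<rho>\<bar>) / (2 * \<bar>\<rho>\<bar>) * s \<le> \<bar>X 0 \<omega>\<bar>}"
  let ?t = "tail (\<bar>\<rho>\<bar> / 2 * s)"
  have cover: "{\<omega> \<in> space M. s \<le> \<bar>X 0 \<omega>\<bar>} \<subseteq> ?F (\<bar>\<rho>\<bar> * s / 2) \<union> ?B \<union> ?F (d * s / 2) \<union> ?T"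
  proof
    fix \<omega> assume \<omega>: "\<omega> \<in> {\<omega> \<in> space M. s \<le> \<bar>X 0 \<omega>\<bar>}"
    define x y where "x = X 0 \<omega>" and "y = X (0 + 1) \<omega>"
    have x: "s \<le> \<bar>x\<bar>" using \<omega> by (simp add: x_def)
    have rx: "\<bar>\<rho>\<bar> * s \<le> \<bar>\<rho> * x\<bar>" unfolding abs_mult using x r by simp
    consider "\<bar>y\<bar> < \<bar>\<rho>\<bar> * s / 2" | "\<bar>\<rho>\<bar> * s / 2 \<le> \<bar>y\<bar>" "\<bar>y\<bar> < s" | "s \<le> \<bar>y\<bar>" by linarith
    then show "\<omega> \<in> ?F (\<bar>\<rho>\<bar> * s / 2) \<union> ?B \<union> ?F (d * s / 2) \<union> ?T"
    proof cases
      case 1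
      then have "\<bar>\<rho>\<bar> * s / 2 \<le> \<bar>y - \<rho> * x\<bar>" using rx by linarith
      then show ?thesis using \<omega> by (simp add: x_def y_def)
    next
      case 2
      have "\<bar>\<rho> * y\<bar> \<le> \<bar>\<rho>\<bar> * s" unfolding abs_mult using 2 r by simp
      then have "s - \<bar>\<rho>\<bar> * s \<le> \<bar>x - \<rho> * y\<bar>" using x by linarith
      then have "d * s \<le> \<bar>x - \<rho> * y\<bar>" by (simp add: d_def left_diff_distrib)
      then show ?thesis using \<omega> 2 by (simp add: x_def y_def)
    next
      case 3
      show ?thesis
      proof (cases "(1 + \<bar>\<rho>\<bar>) / (2 * \<bar>\<rho>\<bar>) * s \<le> \<bar>x\<bar>")
        case True
        then show ?thesis using \<omega> by (simp add: x_def)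
      next
        case False
        then have "\<bar>\<rho>\<bar> * \<bar>x\<bar> < \<bar>\<rho>\<bar> * ((1 + \<bar>\<rho>\<bar>) / (2 * \<bar>\<rho>\<bar>) * s)"
          using r by (intro mult_strict_left_mono) auto
        also have "\<dots> = (1 + \<bar>\<rho>\<bar>) * s / 2" using r by simp
        finally have "\<bar>\<rho> * x\<bar> < (1 + \<bar>\<rho>\<bar>) * s / 2" by (simp add: abs_mult)
        moreover have "s - (1 + \<bar>\<rho>\<bar>) * s / 2 = d * s / 2" by (simp add: d_def field_simps)
        ultimately have "d * s / 2 \<le> \<bar>y - \<rho> * x\<bar>" using 3 by linarith
        then show ?thesis using \<omega> by (simp add: x_def y_def)
      qed
    qed
  qed
  have "tail s \<le> prob (?F (\<bar>\<rho>\<bar> * s / 2) \<union> ?B \<union> ?F (d * s / 2) \<union> ?T)"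
    unfolding tail_def by (intro finite_measure_mono cover) measurable
  also have "\<dots> \<le> prob (?F (\<bar>\<rho>\<bar> * s / 2)) + prob ?B + prob (?F (d * s / 2)) + prob ?T"
    by (intro order_trans[OF measure_Un_le] add_right_mono) measurable
  also have "prob ?T = tail ((1 + \<bar>\<rho>\<bar>) / (2 * \<bar>\<rho>\<bar>) * s)" by (simp add: tail_def)
  finally have "tail s \<le> prob (?F (\<bar>\<rho>\<bar> * s / 2)) + prob ?B + prob (?F (d * s / 2))
      + tail ((1 + \<bar>\<rho>\<bar>) / (2 * \<bar>\<rho>\<bar>) * s)" .
  moreover have F: "prob (?F t) \<le> (1 - \<rho>\<^sup>2) / t\<^sup>2 * ?t" if "t > 0" for t
  proof -
    have "tail s \<le> ?t"
      using s abs_rho_less_1 by (intro tail_antimono) (simp add: mult_left_le_one_le)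
    then show ?thesis
      using v by (intro order_trans[OF conditional_chebyshev[OF that]] mult_left_mono) auto
  qed
  moreover have "prob (?F (\<bar>\<rho>\<bar> * s / 2)) \<le> (1 - \<rho>\<^sup>2) * (4 / \<rho>\<^sup>2) / s\<^sup>2 * ?t"
    using F[of "\<bar>\<rho>\<bar> * s / 2"] r s by (simp add: power_mult_distrib power_divide)
  moreover have "prob (?F (d * s / 2)) \<le> (1 - \<rho>\<^sup>2) * (4 / d\<^sup>2) / s\<^sup>2 * ?t"
    using F[of "d * s / 2"] d s by (simp add: power_mult_distrib power_divide)
  moreover have "prob ?B \<le> (1 - \<rho>\<^sup>2) * (1 / d\<^sup>2) / s\<^sup>2 * ?t"
    using conditional_chebyshev_backward[of "d * s" "\<bar>\<rho>\<bar> / 2 * s" 0] d s by (simp add: power_mult_distrib)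
  moreover have "(1 - \<rho>\<^sup>2) * (4 / \<rho>\<^sup>2 + 5 / d\<^sup>2) / s\<^sup>2 * ?t =
     (1 - \<rho>\<^sup>2) * (4 / \<rho>\<^sup>2) / s\<^sup>2 * ?t + (1 - \<rho>\<^sup>2) * (1 / d\<^sup>2) / s\<^sup>2 * ?t + (1 - \<rho>\<^sup>2) * (4 / d\<^sup>2) / s\<^sup>2 * ?t"
  proof -
    have "4 / \<rho>\<^sup>2 + 5 / d\<^sup>2 = 4 / \<rho>\<^sup>2 + 1 / d\<^sup>2 + 4 / d\<^sup>2" by simp
    then show ?thesis by (simp only: distrib_left distrib_right add_divide_distrib)
  qed
  ultimately show ?thesis unfolding d_def[symmetric] by linarith
qed

lemma tail_le: "s > 0 \<Longrightarrow> tail s \<le> 1 / s\<^sup>2"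
  using Chebyshev_inequality[of "X 0" s] X_square_integrable mean_zero second_moment_one
  by (simp add: tail_def)

text \<open>
  Iterating the previous bound along \<open>s\<close>, \<open>\<kappa> * s\<close>, \<open>\<kappa>\<^sup>2 * s\<close>, \<dots>, the deviation terms form a
  geometric series and the remaining tail tends to \<open>0\<close>.
\<close>

lemma tail_decay:
  "\<exists>D. \<forall>s>0. tail s \<le> D / s\<^sup>2 * tail (\<bar>\<rho>\<bar> / 2 * s)"
proof -
  define c where "c = (1 - \<rho>\<^sup>2) * (4 / \<rho>\<^sup>2 + 5 / (1 - \<bar>\<rho>\<bar>)\<^sup>2)"
  define \<kappa> where "\<kappa> = (1 + \<bar>\<rho>\<bar>) / (2 * \<bar>\<rho>\<bar>)"
  define x where "x = 1 / \<kappa>\<^sup>2"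
  have \<kappa>: "\<kappa> > 1" using rho_nonzero abs_rho_less_1 by (simp add: \<kappa>_def)
  have c: "c \<ge> 0" using abs_rho_less_1 by (simp add: c_def abs_square_le_1)
  have x: "0 < x" "x < 1" using \<kappa> by (simp_all add: x_def)
  have step: "tail s \<le> c / s\<^sup>2 * tail (\<bar>\<rho>\<bar> / 2 * s) + tail (\<kappa> * s)" if "s > 0" for s
    using tail_step[OF that] by (simp add: c_def \<kappa>_def)
  have "tail s \<le> c / (1 - x) / s\<^sup>2 * tail (\<bar>\<rho>\<bar> / 2 * s)" if s: "s > 0" for s
  proof -
    let ?t = "tail (\<bar>\<rho>\<bar> / 2 * s)"
    have iter: "tail s \<le> c / s\<^sup>2 * ?t * (\<Sum>i<n. x ^ i) + tail (\<kappa> ^ n * s)" for n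
    proof (induction n)
      case (Suc n)
      have pos: "\<kappa> ^ n * s > 0" using \<kappa> s by simp
      have "\<kappa> ^ n \<ge> 1" using \<kappa> by simp
      then have "\<bar>\<rho>\<bar> / 2 * s \<le> \<bar>\<rho>\<bar> / 2 * (\<kappa> ^ n * s)"
        using s by (intro mult_left_mono) auto
      note mono = tail_antimono[OF this]
      have "c / (\<kappa> ^ n * s)\<^sup>2 * tail (\<bar>\<rho>\<bar> / 2 * (\<kappa> ^ n * s)) \<le> c / (\<kappa> ^ n * s)\<^sup>2 * ?t"
        using c by (intro mult_left_mono mono) auto
      also have "\<dots> = c / s\<^sup>2 * ?t * x ^ n"
        by (simp add: x_def power_mult_distrib power_divide power_mult[symmetric] mult.commute)
      finally show ?case
        using Suc step[OF pos] by (simp add: distrib_left mult.assoc)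
    qed simp
    have "tail s \<le> c / s\<^sup>2 * ?t * (1 / (1 - x)) + 1 / s\<^sup>2 * x ^ n" for n
    proof -
      have "(\<Sum>i<n. x ^ i) \<le> 1 / (1 - x)"
        using x by (simp add: sum_gp_strict divide_right_mono)
      then have "c / s\<^sup>2 * ?t * (\<Sum>i<n. x ^ i) \<le> c / s\<^sup>2 * ?t * (1 / (1 - x))"
        using c tail_nonneg by (intro mult_left_mono) auto
      moreover have "tail (\<kappa> ^ n * s) \<le> 1 / s\<^sup>2 * x ^ n"
        using tail_le[of "\<kappa> ^ n * s"] \<kappa> s
        by (simp add: x_def power_mult_distrib power_divide power_mult[symmetric] mult.commute)
      ultimately show ?thesis using iter[of n] by linarith
    qed
    moreover have "(\<lambda>n. c / s\<^sup>2 * ?t * (1 / (1 - x)) + 1 / s\<^sup>2 * x ^ n) \<longlonglongrightarrow> c / s\<^sup>2 * ?t * (1 / (1 - x)) + 1 / s\<^sup>2 * 0"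
      using x by (intro tendsto_intros LIMSEQ_realpow_zero) auto
    ultimately have "tail s \<le> c / s\<^sup>2 * ?t * (1 / (1 - x)) + 1 / s\<^sup>2 * 0"
      by (intro LIMSEQ_le_const) auto
    then show ?thesis by (simp add: mult_ac)
  qed
  then show ?thesis by blast
qed

lemma X_has_moments: "has_moments M (X k)"
proof -
  obtain D where "\<And>s. s > 0 \<Longrightarrow> tail s \<le> D / s\<^sup>2 * tail (\<bar>\<rho>\<bar> / 2 * s)"
    using tail_decay by blast
  then show ?thesis
    using rho_nonzero by (intro has_moments_if_tail[of "X k" "\<bar>\<rho>\<bar> / 2" D]) (simp_all only: tail_eq, auto)
qed

end

section \<open>Prediction of the q-Hermite polynomials\<close>

text \<open>
  The linear algebra of the induction step below. There \<open>P = \<rho> ^ m\<close>, \<open>y i\<close> is the unknown mixed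
  moment of degree \<open>m + 2\<close> at time \<open>i\<close>, and \<open>e1\<close>, \<open>e3\<close> are the known ones of degrees \<open>m\<close> and
  \<open>m - 2\<close>. The relation between the coefficients makes \<open>e3\<close> drop out, and the value of \<open>q\<close> is the one
  for which \<open>e1\<close> drops out.
\<close>

lemma regression_algebra:
  fixes r P :: real
  assumes nz: "r \<noteq> 0" "P \<noteq> 0" and a: "a * (1 + r\<^sup>2) = r"
    and AB: "A * (r\<^sup>2 + 1 / r\<^sup>2) + B = 1" and C: "C = 1 - 2 * A - B * r\<^sup>2"
    and q: "q * C = 2 * A + B / r\<^sup>2 - 1" and D: "1 - A * (1 + r\<^sup>2) \<noteq> 0"
    and k1: "k1 = q * k + 1"
    and lin: "r * P * (y1 + k1 * (P * e1)) = a * (r\<^sup>2 * P\<^sup>2 * (y0 + k1 * e1) + (y2 + k1 * (P\<^sup>2 * e1)))"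
    and quad: "P * (y1 + (k1 + k) * (P * e1) + w * (P / r\<^sup>2 * e3)) =
       A * (P\<^sup>2 * (y0 + (k1 + k) * e1 + w * e3) + (y2 + (k1 + k) * (P\<^sup>2 * e1) + w * ((P / r\<^sup>2)\<^sup>2 * e3)))
       + B * (r\<^sup>2 * P\<^sup>2 * (y0 + k1 * e1) + P\<^sup>2 / r\<^sup>2 * (k * e1 + w * e3)) + C * (P\<^sup>2 * e1)"
  shows "y1 = r\<^sup>2 * P * y0"
proof -
  define t where "t = r\<^sup>2"
  define u where "u = 1 / t"
  have ut: "u * t = 1" using nz by (simp add: u_def t_def)
  have "r * ((1 + t) * (P * (y1 + k1 * (P * e1)))) = r * (t * P\<^sup>2 * (y0 + k1 * e1) + (y2 + k1 * (P\<^sup>2 * e1)))"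
  proof -
    have "(1 + t) * (r * P * (y1 + k1 * (P * e1))) = (a * (1 + t)) * (t * P\<^sup>2 * (y0 + k1 * e1) + (y2 + k1 * (P\<^sup>2 * e1)))"
      unfolding lin[folded t_def] by (simp only: mult_ac)
    then show ?thesis unfolding a[folded t_def] by (simp only: mult_ac)
  qed
  then have "(1 + t) * (P * (y1 + k1 * (P * e1))) = t * P\<^sup>2 * (y0 + k1 * e1) + (y2 + k1 * (P\<^sup>2 * e1))"
    unfolding mult_cancel_left using nz by blast
  then have y2: "y2 = (1 + t) * P * y1 - t * P\<^sup>2 * y0"
    by (simp add: power2_eq_square algebra_simps)
  have e1: "2 * A * (k1 + k) + B * t * k1 + B * u * k + C = k1 + k"
  proof -
    have C': "C = 1 - 2 * A - B * t" and q': "q * C = 2 * A + B * u - 1"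
      using C q by (simp_all add: t_def u_def)
    have "2 * A * (k1 + k) + B * t * k1 + B * u * k + C - (k1 + k) =
        k * (2 * A + B * u - 1) - k1 * (1 - 2 * A - B * t) + C"
      by (simp add: algebra_simps)
    also have "\<dots> = 0"
      unfolding q'[symmetric] C'[symmetric] k1 by (simp add: algebra_simps)
    finally show ?thesis by simp
  qed
  have e3: "A + A * u * u + B * u = u"
  proof -
    have "u * (A * (t + u) + B) = u" using AB by (simp add: t_def u_def)
    then have "A * (u * t) + A * u * u + B * u = u" by (simp add: algebra_simps)
    then show ?thesis unfolding ut by simp
  qed
  have "P * y1 + P\<^sup>2 * e1 * (k1 + k) + w * P\<^sup>2 * e3 * u =
     A * (P\<^sup>2 * y0 + y2) + B * t * P\<^sup>2 * y0
     + P\<^sup>2 * e1 * (2 * A * (k1 + k) + B * t * k1 + B * u * k + C) + w * P\<^sup>2 * e3 * (A + A * u * u + B * u)"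
    using quad[folded t_def] by (simp add: u_def power2_eq_square add_divide_distrib algebra_simps)
  then have "P * y1 = A * (P\<^sup>2 * y0 + y2) + B * t * P\<^sup>2 * y0"
    unfolding e1 e3 by simp
  also have "B * t = t - A * (t * t + 1)"
  proof -
    have "(A * (t + u) + B) * t = t" using AB by (simp add: t_def u_def)
    then have "A * t * t + A * (u * t) + B * t = t" by (simp add: algebra_simps)
    then show ?thesis unfolding ut by (simp add: algebra_simps)
  qed
  finally have "P * ((1 - A * (1 + t)) * y1) = P * ((1 - A * (1 + t)) * (t * P * y0))"
    unfolding y2 by (simp add: power2_eq_square algebra_simps)
  then show ?thesis using nz D by (simp add: t_def)
qed

context nonneg_quadratic_regression
begin

text \<open>
  This parameter is chosen so that \<open>hermite_prediction\<close> holds; \<open>q_eq\<close> expresses it through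
  \<open>\<rho>\<close> and \<open>R\<close>.
\<close>

definition q :: real where "q = (2 * A + B / \<rho>\<^sup>2 - 1) / C"

lemma C_nonzero: "C \<noteq> 0"
  using nondegenerate abs_rho_less_1 unfolding C_factor by (auto simp: abs_square_eq_1)

abbreviation "H \<equiv> q_hermite q"

lemma moments_H: "has_moments M (\<lambda>\<omega>. H n (X k \<omega>))"
  by (intro has_moments_q_hermite X_has_moments)

lemma expectation_times_H:
  assumes Z: "has_moments M Z"
  shows "expectation (\<lambda>\<omega>. X i \<omega> * (H n (X i \<omega>) * Z \<omega>)) =
    expectation (\<lambda>\<omega>. H (Suc n) (X i \<omega>) * Z \<omega>) + q_number q n * expectation (\<lambda>\<omega>. H (n - 1) (X i \<omega>) * Z \<omega>)"
proof -
  have "X i \<omega> * (H n (X i \<omega>) * Z \<omega>) = H (Suc n) (X i \<omega>) * Z \<omega> + q_number q n * (H (n - 1) (X i \<omega>) * Z \<omega>)" for \<omega>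
    unfolding mult.assoc[symmetric] times_q_hermite by (simp add: distrib_right)
  then show ?thesis
    using has_momentsD(3)[OF has_moments_mult[OF moments_H Z]] by simp
qed

lemma expectation_times_H_pred:
  assumes Z: "has_moments M Z"
  shows "q_number q n * expectation (\<lambda>\<omega>. X i \<omega> * (H (n - 1) (X i \<omega>) * Z \<omega>)) =
    q_number q n * (expectation (\<lambda>\<omega>. H n (X i \<omega>) * Z \<omega>) + q_number q (n - 1) * expectation (\<lambda>\<omega>. H (n - 2) (X i \<omega>) * Z \<omega>))"
  unfolding expectation_times_H[OF Z] by (cases n) (auto simp: numeral_2_eq_2)

lemma expectation_square_times_H:
  assumes Z: "has_moments M Z"
  shows "expectation (\<lambda>\<omega>. (X i \<omega>)\<^sup>2 * (H n (X i \<omega>) * Z \<omega>)) = expectation (\<lambda>\<omega>. H (Suc (Suc n)) (X i \<omega>) * Z \<omega>)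
    + (q_number q (Suc n) + q_number q n) * expectation (\<lambda>\<omega>. H n (X i \<omega>) * Z \<omega>)
    + q_number q n * q_number q (n - 1) * expectation (\<lambda>\<omega>. H (n - 2) (X i \<omega>) * Z \<omega>)"
proof -
  have "expectation (\<lambda>\<omega>. (X i \<omega>)\<^sup>2 * (H n (X i \<omega>) * Z \<omega>)) = expectation (\<lambda>\<omega>. X i \<omega> * (H n (X i \<omega>) * (X i \<omega> * Z \<omega>)))"
    by (simp add: power2_eq_square mult_ac)
  also have "\<dots> = expectation (\<lambda>\<omega>. X i \<omega> * (H (Suc n) (X i \<omega>) * Z \<omega>))
      + q_number q n * expectation (\<lambda>\<omega>. X i \<omega> * (H (n - 1) (X i \<omega>) * Z \<omega>))"
    by (subst expectation_times_H[OF has_moments_mult[OF X_has_moments Z]]) (simp add: mult.left_commute)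
  finally show ?thesis
    unfolding expectation_times_H_pred[OF Z] expectation_times_H[OF Z, of i "Suc n"]
    by (simp add: algebra_simps del: q_hermite.simps)
qed

text \<open>
  The polynomials \<open>H n\<close> are eigenfunctions of one-step prediction, with eigenvalue \<open>\<rho> ^ n\<close>. As for
  second moments, two mixed moments are each computed in two ways: one uses the linear
  regression and the other the quadratic one. The resulting two equations determine the value at time
  \<open>k + 1\<close> from the value at time \<open>k\<close>.
\<close>

lemma hermite_prediction:
  "past k Z \<Longrightarrow> has_moments M Z \<Longrightarrow>
    expectation (\<lambda>\<omega>. H n (X (k + 1) \<omega>) * Z \<omega>) = \<rho> ^ n * expectation (\<lambda>\<omega>. H n (X k \<omega>) * Z \<omega>)"
proof (induction n arbitrary: k Z rule: less_induct)
  case (less n)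
  consider "n = 0" | "n = 1" | m where "n = Suc (Suc m)"
    by (cases n rule: nat.exhaust[case_product nat.exhaust[of "n - 1"]]) auto
  then show ?case
  proof cases
    case 1
    then show ?thesis by simp
  next
    case 2
    then show ?thesis
      using linear_prediction_1[OF less.prems(1) has_momentsD(2)[OF less.prems(2)]] by simp
  next
    case (3 m)
    note Z = less.prems
    have pred1: "expectation (\<lambda>\<omega>. H j (X (i + 1) \<omega>) * W \<omega>) = \<rho> ^ j * expectation (\<lambda>\<omega>. H j (X i \<omega>) * W \<omega>)"
      if "j \<le> Suc m" "past i W" "has_moments M W" for i j W
      using less.IH[of j i W] that 3 by simp
    have pred2: "expectation (\<lambda>\<omega>. H j (X (k + 2) \<omega>) * W \<omega>) = (\<rho> ^ j)\<^sup>2 * expectation (\<lambda>\<omega>. H j (X k \<omega>) * W \<omega>)"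
      if "j \<le> Suc m" "past k W" "has_moments M W" for j W
      using pred1[of j "k + 1" W] pred1[of j k W] that past_mono[OF that(2), of "k + 1"]
      by (simp add: power2_eq_square add.commute)
    define y where "y i = expectation (\<lambda>\<omega>. H n (X (k + i) \<omega>) * Z \<omega>)" for i
    define e1 where "e1 = expectation (\<lambda>\<omega>. H m (X k \<omega>) * Z \<omega>)"
    define e3 where "e3 = expectation (\<lambda>\<omega>. H (m - 2) (X k \<omega>) * Z \<omega>)"
    define c c1 w where "c = q_number q m" and "c1 = q_number q (Suc m)"
      and "w = q_number q m * q_number q (m - 1)"
    define P where "P = \<rho> ^ m"
    \<comment> \<open>the coefficients \<open>c\<close> and \<open>w\<close> vanish whenever a subtraction in an exponent truncates\<close>
    have Pm: "c * \<rho> ^ (m - 1) = c * (P / \<rho>)" "w * \<rho> ^ (m - 2) = w * (P / \<rho>\<^sup>2)"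
    proof -
      show "c * \<rho> ^ (m - 1) = c * (P / \<rho>)"
        using rho_nonzero by (cases m) (auto simp: c_def P_def)
      show "w * \<rho> ^ (m - 2) = w * (P / \<rho>\<^sup>2)"
      proof (cases "m \<le> 1")
        case True
        then have "w = 0" by (cases m) (auto simp: w_def)
        then show ?thesis by simp
      next
        case False
        then have "m = (m - 2) + 2" by simp
        then have "P = \<rho> ^ (m - 2) * \<rho>\<^sup>2" unfolding P_def by (metis power_add)
        then show ?thesis using rho_nonzero by simp
      qed
    qed
    note mX = has_moments_mult[OF X_has_moments Z(2)]
    have E1: "expectation (\<lambda>\<omega>. H m (X (k + 1) \<omega>) * Z \<omega>) = P * e1"
      "expectation (\<lambda>\<omega>. H m (X (k + 2) \<omega>) * Z \<omega>) = P\<^sup>2 * e1"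
      using pred1[of m k Z] pred2[of m Z] Z by (simp_all add: P_def e1_def)
    have E3: "w * expectation (\<lambda>\<omega>. H (m - 2) (X (k + 1) \<omega>) * Z \<omega>) = w * (P / \<rho>\<^sup>2 * e3)"
      "w * expectation (\<lambda>\<omega>. H (m - 2) (X (k + 2) \<omega>) * Z \<omega>) = w * ((P / \<rho>\<^sup>2)\<^sup>2 * e3)"
    proof -
      have power: "\<rho> ^ (m - 2) = P / \<rho>\<^sup>2" if "w \<noteq> 0"
        using Pm(2) that unfolding mult_cancel_left by blast
      show "w * expectation (\<lambda>\<omega>. H (m - 2) (X (k + 1) \<omega>) * Z \<omega>) = w * (P / \<rho>\<^sup>2 * e3)"
        using pred1[of "m - 2" k Z] Z power by (cases "w = 0") (simp_all add: e3_def)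
      show "w * expectation (\<lambda>\<omega>. H (m - 2) (X (k + 2) \<omega>) * Z \<omega>) = w * ((P / \<rho>\<^sup>2)\<^sup>2 * e3)"
        using pred2[of "m - 2" Z] Z power by (cases "w = 0") (simp_all add: e3_def)
    qed
    have n: "n = Suc (Suc m)" by fact
    have XH: "expectation (\<lambda>\<omega>. X (k + i) \<omega> * (H (Suc m) (X (k + i) \<omega>) * Z \<omega>)) =
        y i + c1 * expectation (\<lambda>\<omega>. H m (X (k + i) \<omega>) * Z \<omega>)" for i
      unfolding expectation_times_H[OF Z(2)] by (simp add: y_def n c1_def)
    have XXH: "expectation (\<lambda>\<omega>. (X (k + i) \<omega>)\<^sup>2 * (H m (X (k + i) \<omega>) * Z \<omega>)) =
        y i + (c1 + c) * expectation (\<lambda>\<omega>. H m (X (k + i) \<omega>) * Z \<omega>)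
        + w * expectation (\<lambda>\<omega>. H (m - 2) (X (k + i) \<omega>) * Z \<omega>)" for i
      unfolding expectation_square_times_H[OF Z(2)] by (simp add: y_def n c1_def c_def w_def)
    have int: "integrable M (\<lambda>\<omega>. X i \<omega> * (H j (X l \<omega>) * Z \<omega>))"
        "integrable M (\<lambda>\<omega>. (X i \<omega>)\<^sup>2 * (H j (X l \<omega>) * Z \<omega>))"
        "integrable M (\<lambda>\<omega>. X i \<omega> * (X i' \<omega> * (H j (X l \<omega>) * Z \<omega>)))"
        "integrable M (\<lambda>\<omega>. H j (X l \<omega>) * Z \<omega>)" for i i' j l
      unfolding power2_eq_square mult.assoc
      by (intro has_momentsD(3) has_moments_mult moments_H X_has_moments Z(2))+
    have test: "(\<lambda>\<omega>. H j (X (k + 2) \<omega>) * Z \<omega>) \<in> borel_measurable (sigma_others M X (k + 1))" for j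
      using pastD[OF Z(1), of "k + 1"] measurable_compose[OF X_measurable_others borel_measurable_q_hermite, of "k + 2" "k + 1"]
      by (intro borel_measurable_times) auto
    have pk: "past k (\<lambda>\<omega>. X k \<omega> * Z \<omega>)" "past (k + 1) (\<lambda>\<omega>. X (k + 1) \<omega> * Z \<omega>)"
      "past (k + 1) (\<lambda>\<omega>. (X (k + 1) \<omega>)\<^sup>2 * Z \<omega>)" "past k (\<lambda>\<omega>. (X k \<omega>)\<^sup>2 * Z \<omega>)"
      unfolding power2_eq_square
      using Z(1) past_mono[OF Z(1), of "k + 1"] by (auto intro!: past_mult past_X)
    have mXX: "has_moments M (\<lambda>\<omega>. (X i \<omega>)\<^sup>2 * Z \<omega>)" for i
      unfolding power2_eq_square by (intro has_moments_mult X_has_moments Z(2))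
    \<comment> \<open>two evaluations of the mixed moment of \<open>X (k + 1)\<close> and \<open>H (Suc m) (X (k + 2))\<close>\<close>
    have lin: "\<rho> * P * (y 1 + c1 * (P * e1)) = a * (\<rho>\<^sup>2 * P\<^sup>2 * (y 0 + c1 * e1) + (y 2 + c1 * (P\<^sup>2 * e1)))"
    proof -
      have "expectation (\<lambda>\<omega>. X (k + 1) \<omega> * (H (Suc m) (X (k + 2) \<omega>) * Z \<omega>)) = \<rho> * P * (y 1 + c1 * (P * e1))"
        using pred1[OF order_refl pk(2) mX] XH[of 1] E1(1) by (simp add: P_def mult.left_commute add.commute)
      moreover have "expectation (\<lambda>\<omega>. X (k + 1) \<omega> * (H (Suc m) (X (k + 2) \<omega>) * Z \<omega>)) =
        a * (expectation (\<lambda>\<omega>. X k \<omega> * (H (Suc m) (X (k + 2) \<omega>) * Z \<omega>)) + (y 2 + c1 * (P\<^sup>2 * e1)))"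
        using linear_regression_test'[OF test int(1) int(1) int(1), of "Suc m"] XH[of 2] E1(2) by (simp add: add.commute)
      moreover have "expectation (\<lambda>\<omega>. X k \<omega> * (H (Suc m) (X (k + 2) \<omega>) * Z \<omega>)) = \<rho>\<^sup>2 * P\<^sup>2 * (y 0 + c1 * e1)"
        using pred2[OF order_refl pk(1) mX] XH[of 0] by (simp add: P_def e1_def mult.left_commute power_mult_distrib)
      ultimately show ?thesis by simp
    qed
    \<comment> \<open>two evaluations of the mixed moment of \<open>(X (k + 1))\<^sup>2\<close> and \<open>H m (X (k + 2))\<close>\<close>
    have quad: "P * (y 1 + (c1 + c) * (P * e1) + w * (P / \<rho>\<^sup>2 * e3)) =
       A * (P\<^sup>2 * (y 0 + (c1 + c) * e1 + w * e3) + (y 2 + (c1 + c) * (P\<^sup>2 * e1) + w * ((P / \<rho>\<^sup>2)\<^sup>2 * e3)))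
       + B * (\<rho>\<^sup>2 * P\<^sup>2 * (y 0 + c1 * e1) + P\<^sup>2 / \<rho>\<^sup>2 * (c * e1 + w * e3)) + C * (P\<^sup>2 * e1)"
    proof -
      have "expectation (\<lambda>\<omega>. (X (k + 1) \<omega>)\<^sup>2 * (H m (X (k + 2) \<omega>) * Z \<omega>)) =
          P * (y 1 + (c1 + c) * (P * e1) + w * (P / \<rho>\<^sup>2 * e3))"
        using pred1[OF _ pk(3) mXX, of m] XXH[of 1] E1(1) E3(1) by (simp add: P_def mult.left_commute add.commute)
      moreover have "expectation (\<lambda>\<omega>. (X k \<omega>)\<^sup>2 * (H m (X (k + 2) \<omega>) * Z \<omega>)) =
          P\<^sup>2 * (y 0 + (c1 + c) * e1 + w * e3)"
        using pred2[OF _ pk(4) mXX, of m] XXH[of 0] by (simp add: P_def e1_def e3_def mult.left_commute)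
      moreover have "expectation (\<lambda>\<omega>. (X (k + 2) \<omega>)\<^sup>2 * (H m (X (k + 2) \<omega>) * Z \<omega>)) =
          y 2 + (c1 + c) * (P\<^sup>2 * e1) + w * ((P / \<rho>\<^sup>2)\<^sup>2 * e3)"
        using XXH[of 2] E1(2) E3(2) by simp
      moreover have "expectation (\<lambda>\<omega>. X (k + 2) \<omega> * (X k \<omega> * (H m (X (k + 2) \<omega>) * Z \<omega>))) =
          \<rho>\<^sup>2 * P\<^sup>2 * (y 0 + c1 * e1) + P\<^sup>2 / \<rho>\<^sup>2 * (c * e1 + w * e3)"
      proof -
        have "expectation (\<lambda>\<omega>. X (k + 2) \<omega> * (X k \<omega> * (H m (X (k + 2) \<omega>) * Z \<omega>))) =
            expectation (\<lambda>\<omega>. X (k + 2) \<omega> * (H m (X (k + 2) \<omega>) * (X k \<omega> * Z \<omega>)))"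
          by (simp add: mult.left_commute)
        also have "\<dots> = (\<rho> ^ Suc m)\<^sup>2 * expectation (\<lambda>\<omega>. H (Suc m) (X k \<omega>) * (X k \<omega> * Z \<omega>))
            + c * ((\<rho> ^ (m - 1))\<^sup>2 * expectation (\<lambda>\<omega>. H (m - 1) (X k \<omega>) * (X k \<omega> * Z \<omega>)))"
          unfolding expectation_times_H[OF mX] using pred2[OF _ pk(1) mX] by (simp add: c_def)
        also have "expectation (\<lambda>\<omega>. H (Suc m) (X k \<omega>) * (X k \<omega> * Z \<omega>)) = y 0 + c1 * e1"
          using XH[of 0] by (simp add: e1_def mult.left_commute)
        also have "c * ((\<rho> ^ (m - 1))\<^sup>2 * expectation (\<lambda>\<omega>. H (m - 1) (X k \<omega>) * (X k \<omega> * Z \<omega>))) =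
            (\<rho> ^ (m - 1))\<^sup>2 * (c * expectation (\<lambda>\<omega>. X k \<omega> * (H (m - 1) (X k \<omega>) * Z \<omega>)))"
          by (simp add: mult.left_commute)
        also have "\<dots> = (\<rho> ^ (m - 1))\<^sup>2 * (c * (e1 + q_number q (m - 1) * e3))"
          unfolding c_def expectation_times_H_pred[OF Z(2)] e1_def e3_def ..
        also have "\<dots> = P\<^sup>2 / \<rho>\<^sup>2 * (c * e1 + w * e3)"
        proof (cases "c = 0")
          case False
          then have "\<rho> ^ (m - 1) = P / \<rho>" using Pm(1) unfolding mult_cancel_left by blast
          then show ?thesis by (simp add: power_divide w_def c_def distrib_left)
        qed (simp add: w_def c_def)
        finally show ?thesis by (simp add: P_def power_mult_distrib)
      qed
      ultimately show ?thesis
        using quadratic_regression_test'[OF test int(2) int(2) int(2) int(3) int(4), of m] E1(2)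
        by (simp add: add.commute)
    qed
    have "y 1 = \<rho>\<^sup>2 * P * y 0"
    proof (rule regression_algebra[OF rho_nonzero _ a_eq coefficients_rho C_eq _ nondegenerate _ lin quad])
      show "P \<noteq> 0" using rho_nonzero by (simp add: P_def)
      show "q * C = 2 * A + B / \<rho>\<^sup>2 - 1" using C_nonzero by (simp add: q_def)
      show "c1 = q * c + 1" by (simp add: c1_def c_def q_number_Suc)
    qed
    then show ?thesis by (simp add: y_def P_def n power2_eq_square)
  qed
qed

text \<open>
  Tested against the constant \<open>1\<close>, prediction multiplies the mean by \<open>\<rho> ^ n\<close>, while equality of the
  one-dimensional laws leaves it unchanged.
\<close>

lemma expectation_H: "n > 0 \<Longrightarrow> expectation (\<lambda>\<omega>. H n (X 0 \<omega>)) = 0"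
proof -
  assume n: "n > 0"
  have "expectation (\<lambda>\<omega>. H n (X k \<omega>)) = (\<integral>x. H n x \<partial>distr M borel (X k))" for k
    by (subst integral_distr) auto
  then have "expectation (\<lambda>\<omega>. H n (X 1 \<omega>)) = expectation (\<lambda>\<omega>. H n (X 0 \<omega>))"
    using same_distribution[of 1] by simp
  then have "expectation (\<lambda>\<omega>. H n (X 0 \<omega>)) = \<rho> ^ n * expectation (\<lambda>\<omega>. H n (X 0 \<omega>))"
    using hermite_prediction[OF past_const[of 0 1] has_moments_const, of n] by simp
  moreover have "\<bar>\<rho> ^ n\<bar> < 1"
    using abs_rho_less_1 n by (simp add: power_abs power_less_one_iff)
  then have "\<rho> ^ n \<noteq> 1" by auto
  ultimately show ?thesis by simp
qed

lemma moments: "expectation (\<lambda>\<omega>. X 0 \<omega> ^ n) = q_moment q n 0"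
  by (intro expectation_power_eq_q_moment expectation_H has_momentsD(2)[OF X_has_moments])

lemma q_eq:
  defines "R \<equiv> regression_ratio M X B"
  shows "R \<ge> 0" "q = (R - (1 - \<rho> ^ 4)) / (R * \<rho> ^ 4 + (1 - \<rho> ^ 4))"
proof -
  define t where "t = \<rho>\<^sup>2"
  have t: "0 < t" "t < 1" using rho_nonzero abs_rho_less_1 by (auto simp: t_def abs_square_less_1)
  have t4: "\<rho> ^ 4 = t\<^sup>2" by (simp add: t_def power_mult[symmetric])
  have "\<rho> + 1 / \<rho> = (1 + t) / \<rho>" using rho_nonzero by (simp add: t_def power2_eq_square add_divide_distrib)
  then have R: "R = B * (1 + t)\<^sup>2 / t"
    by (simp add: R_def regression_ratio_def \<rho>_def[symmetric] power_divide t_def[symmetric])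
  show "R \<ge> 0" using B_nonneg t by (simp add: R)
  have Bt: "B * t = t - A * (t * t + 1)" using B_times_square by (simp add: t_def)
  have den: "R * t\<^sup>2 + (1 - t\<^sup>2) > 0"
    using \<open>R \<ge> 0\<close> t by (intro add_nonneg_pos) (auto simp: power_less_one_iff)
  have "q * C * (R * t\<^sup>2 + (1 - t\<^sup>2)) = (R - (1 - t\<^sup>2)) * C"
  proof -
    have qC: "q * C = 2 * A + B / t - 1" using C_nonzero by (simp add: q_def t_def)
    have C: "C = 1 - 2 * A - B * t" using C_eq by (simp add: t_def)
    have Rt: "R * t = B * (1 + t)\<^sup>2" using t by (simp add: R)
    have A: "A * (t * t + 1) = t - B * t" using Bt by simp
    have "(t * t + 1) * t * ((2 * A + B / t - 1) * (R * t\<^sup>2 + (1 - t\<^sup>2))) =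
      (2 * (A * (t * t + 1)) * t + (B - t) * (t * t + 1)) * ((R * t) * t + (1 - t\<^sup>2))"
      using t by (simp add: power2_eq_square field_simps)
    also have "\<dots> = (B * (1 + t)\<^sup>2 - (1 - t\<^sup>2) * t) * ((t * t + 1) - 2 * (A * (t * t + 1)) - B * t * (t * t + 1))"
      unfolding Rt A by (simp add: power2_eq_square algebra_simps)
    also have "\<dots> = (R * t - (1 - t\<^sup>2) * t) * ((t * t + 1) * (1 - 2 * A - B * t))"
      unfolding Rt by (simp add: algebra_simps)
    also have "\<dots> = (t * t + 1) * t * ((R - (1 - t\<^sup>2)) * (1 - 2 * A - B * t))"
      by (simp add: algebra_simps)
    finally have "(2 * A + B / t - 1) * (R * t\<^sup>2 + (1 - t\<^sup>2)) = (R - (1 - t\<^sup>2)) * (1 - 2 * A - B * t)"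
      using t by (simp add: add_pos_pos less_imp_neq[symmetric])
    then show ?thesis unfolding qC C[symmetric] .
  qed
  then have "q * (R * t\<^sup>2 + (1 - t\<^sup>2)) = R - (1 - t\<^sup>2)" using C_nonzero by simp
  then show "q = (R - (1 - \<rho> ^ 4)) / (R * \<rho> ^ 4 + (1 - \<rho> ^ 4))"
    unfolding t4 using den by (simp add: nonzero_eq_divide_eq)
qed

end

section \<open>The one-dimensional law\<close>

lemma (in quadratic_regression_sequence) nonneg_quadratic_regressionI:
  assumes "regression_ratio M X B \<ge> 0"
  shows "nonneg_quadratic_regression M X a b A B C"
proof
  have "\<rho>\<^sup>2 + 1 > 0" by (simp add: add_nonneg_pos)
  then have "\<rho> + 1 / \<rho> \<noteq> 0"
    using rho_nonzero by (auto simp: add_eq_0_iff field_simps power2_eq_square)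
  then have "(\<rho> + 1 / \<rho>)\<^sup>2 > 0" by simp
  then show "B \<ge> 0"
    using assms by (simp add: regression_ratio_def \<rho>_def zero_le_mult_iff)
qed

context nonneg_quadratic_regression
begin

lemma q_cases:
  defines "R \<equiv> regression_ratio M X B"
  shows "R < 2 \<Longrightarrow> - 1 \<le> q \<and> q < 1" "R = 0 \<Longrightarrow> q = - 1" "R = 2 \<Longrightarrow> q = 1" "R > 2 \<Longrightarrow> q > 1"
proof -
  define u where "u = \<rho> ^ 4"
  have u: "0 < u" "u < 1"
    using rho_nonzero abs_rho_less_1 power_less_one_iff[of "\<bar>\<rho>\<bar>" 4] by (auto simp: u_def)
  have R: "R \<ge> 0" and q: "q = (R - (1 - u)) / (R * u + (1 - u))"
    using q_eq by (simp_all add: R_def u_def)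
  have den: "R * u + (1 - u) > 0" using R u by (intro add_nonneg_pos) auto
  have low: "- 1 \<le> q"
  proof -
    have "0 \<le> R * (1 + u)" using R u by simp
    then show ?thesis using den by (simp add: q pos_le_divide_eq algebra_simps)
  qed
  have diff: "(1 - q) * (R * u + (1 - u)) = (2 - R) * (1 - u)"
  proof -
    have "q * (R * u + (1 - u)) = R - (1 - u)" using den by (simp add: q)
    then show ?thesis unfolding left_diff_distrib[of 1 q] by (simp add: algebra_simps)
  qed
  show "- 1 \<le> q \<and> q < 1" if "R < 2"
  proof -
    have "0 < (1 - q) * (R * u + (1 - u))" unfolding diff using u that by simp
    then have "0 < 1 - q" using den by (rule zero_less_mult_pos2)
    then show ?thesis using low by simp
  qed
  show "q = - 1" if "R = 0" using u that by (simp add: q field_simps)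
  show "q = 1" if "R = 2" using diff den that by simp
  show "q > 1" if "R > 2"
  proof -
    have "0 < (q - 1) * (R * u + (1 - u))"
      using diff mult_strict_right_mono[OF that, of "1 - u"] u by (simp add: left_diff_distrib)
    then have "0 < q - 1" using den by (rule zero_less_mult_pos2)
    then show ?thesis by simp
  qed
qed

lemma X_power_integrable: "integrable M (\<lambda>\<omega>. X k \<omega> ^ n)"
  by (rule has_momentsD(2)[OF X_has_moments])

lemma real_distribution_law: "real_distribution (distr M borel (X 0))"
  by (rule real_distribution_distr) simp

lemma law_moments:
  "integrable (distr M borel (X 0)) (\<lambda>x. x ^ n)" "(\<integral>x. x ^ n \<partial>distr M borel (X 0)) = q_moment q n 0"
  using X_power_integrable[of 0 n] moments[of n]
  by (simp_all add: integrable_distr_eq integral_distr)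

lemma q_moment_bound:
  assumes "- 1 \<le> q" "q < 1"
  shows "\<bar>q_moment q n 0\<bar> \<le> (1 + 2 / (1 - q)) ^ n"
  by (intro abs_q_moment_le abs_q_number_le assms)

lemma law_eqI:
  assumes q: "- 1 \<le> q" "q < 1"
    and \<nu>: "real_distribution \<nu>" "\<And>n. integrable \<nu> (\<lambda>x. x ^ n)" "\<And>n. (\<integral>x. x ^ n \<partial>\<nu>) = q_moment q n 0"
  shows "\<nu> = distr M borel (X 0)"
  by (rule moments_determine_distribution[OF \<nu>(1) real_distribution_law \<nu>(2) law_moments(1) \<nu>(3) law_moments(2)])
    (rule geometric_moments_taylor[OF q_moment_bound[OF q]])

lemma law_symmetric:
  assumes q: "- 1 \<le> q" "q < 1"
  shows "distr M borel (\<lambda>\<omega>. - X 0 \<omega>) = distr M borel (X 0)"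
proof (rule law_eqI[OF q])
  show "real_distribution (distr M borel (\<lambda>\<omega>. - X 0 \<omega>))"
    by (rule real_distribution_distr) simp
  have eq: "(- X 0 \<omega>) ^ n = (- 1) ^ n * X 0 \<omega> ^ n" for n \<omega>
    by (rule power_minus)
  show "integrable (distr M borel (\<lambda>\<omega>. - X 0 \<omega>)) (\<lambda>x. x ^ n)" for n
    using X_power_integrable[of 0 n]
    by (subst integrable_distr_eq) (simp_all add: eq)
  have "(\<integral>x. x ^ n \<partial>distr M borel (\<lambda>\<omega>. - X 0 \<omega>)) = (- 1) ^ n * q_moment q n 0" for n
    by (subst integral_distr) (simp_all add: eq moments)
  then show "(\<integral>x. x ^ n \<partial>distr M borel (\<lambda>\<omega>. - X 0 \<omega>)) = q_moment q n 0" for n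
    using q_moment_odd[of n 0 q] by (cases "even n") auto
qed

lemma law_bounded:
  assumes q: "- 1 \<le> q" "q < 1"
  shows "\<exists>l u. AE \<omega> in M. X 0 \<omega> \<in> {l..u}"
proof -
  have "expectation (\<lambda>\<omega>. X 0 \<omega> ^ n) \<le> (1 + 2 / (1 - q)) ^ n" for n
    using q_moment_bound[OF q, of n] by (simp add: moments)
  moreover have "1 + 2 / (1 - q) > 0" using q by (simp add: add_pos_pos)
  ultimately show ?thesis
    using geometric_moments_imp_bounded[OF X_measurable X_power_integrable] by blast
qed

text \<open>At \<open>q = - 1\<close> the second and fourth moments are both \<open>1\<close>, so \<open>X 0 ^ 2 - 1\<close> has second moment \<open>0\<close>.\<close>

lemma law_two_points:
  assumes "q = - 1"
  shows "AE \<omega> in M. X 0 \<omega> = 1 \<or> X 0 \<omega> = - 1"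
    and "prob {\<omega> \<in> space M. X 0 \<omega> = 1} > 0" "prob {\<omega> \<in> space M. X 0 \<omega> = - 1} > 0"
proof -
  note int = X_power_integrable[of 0]
  have m4: "expectation (\<lambda>\<omega>. X 0 \<omega> ^ 4) = 1"
    unfolding moments assms by (simp add: numeral_eq_Suc q_number_Suc)
  have eq: "((X 0 \<omega>)\<^sup>2 - 1)\<^sup>2 = X 0 \<omega> ^ 4 - 2 * (X 0 \<omega>)\<^sup>2 + 1" for \<omega>
    by (simp add: power2_eq_square power4_eq_xxxx algebra_simps)
  have "expectation (\<lambda>\<omega>. ((X 0 \<omega>)\<^sup>2 - 1)\<^sup>2) = 0"
    unfolding eq using int[of 4] int[of 2] m4 second_moment_one by (simp add: prob_space)
  moreover have "integrable M (\<lambda>\<omega>. ((X 0 \<omega>)\<^sup>2 - 1)\<^sup>2)"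
    unfolding eq using int[of 4] int[of 2] by simp
  ultimately have "AE \<omega> in M. ((X 0 \<omega>)\<^sup>2 - 1)\<^sup>2 = 0"
    using integral_nonneg_eq_0_iff_AE[of M "\<lambda>\<omega>. ((X 0 \<omega>)\<^sup>2 - 1)\<^sup>2"] by simp
  then show ae: "AE \<omega> in M. X 0 \<omega> = 1 \<or> X 0 \<omega> = - 1"
    by eventually_elim (simp add: power2_eq_1_iff)
  let ?P = "{\<omega> \<in> space M. X 0 \<omega> = 1}" and ?N = "{\<omega> \<in> space M. X 0 \<omega> = - 1}"
  have ind: "integrable M (indicat_real ?P)" "integrable M (indicat_real ?N)"
    by (auto intro!: integrable_real_indicator simp: emeasure_eq_measure)
  have "prob ?P - prob ?N = expectation (\<lambda>\<omega>. indicator ?P \<omega> - indicator ?N \<omega>)"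
    using ind by simp
  also have "\<dots> = expectation (X 0)"
    using ae by (intro integral_cong_AE) (auto elim!: eventually_mono simp: indicator_def AE_space)
  finally have diff: "prob ?P = prob ?N" using mean_zero by simp
  have "prob ?P + prob ?N = expectation (\<lambda>\<omega>. indicator ?P \<omega> + indicator ?N \<omega>)"
    using ind by simp
  also have "\<dots> = expectation (\<lambda>_. 1)"
    using ae by (intro integral_cong_AE) (auto elim!: eventually_mono simp: indicator_def AE_space)
  finally have "prob ?P + prob ?N = 1" by (simp add: prob_space)
  with diff show "prob ?P > 0" "prob ?N > 0" by simp_all
qed

lemma law_normal:
  assumes "q = 1"
  shows "distributed M lborel (X 0) std_normal_density"
proof -
  have "distr M borel (X 0) = std_normal_distribution"
    using law_moments std_normal_expectation_power integrable_std_normal_distribution_moment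
    by (intro moments_determine_distribution[OF real_distribution_law real_dist_normal_dist _ _ _ _ normal_moments_taylor])
      (simp_all add: assms)
  moreover have "distr M lborel (X 0) = distr M borel (X 0)"
    by (intro distr_cong) simp_all
  ultimately show ?thesis
    by (simp add: distributed_def)
qed

lemma law_indeterminate:
  assumes "q > 1"
  shows "moment_indeterminate (distr M borel (X 0))"
  using q_moments_indeterminate[OF assms] law_moments
  unfolding moment_indeterminate_def by (metis insertCI)

end

theorem theorem3p2:
  fixes M :: "'a measure" and X :: "int \<Rightarrow> 'a \<Rightarrow> real"
    and a b A B C \<rho> R :: real
  assumes "quadratic_regression_sequence M X a b A B C"
    and "\<rho> = correlation M (X 0) (X 1)"
    and "R = regression_ratio M X B"
  shows
    "(0 \<le> R \<and> R < 2 \<longrightarrow>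
        (\<forall>(M' :: 'b measure) X' a' b' A' B' C'.
           quadratic_regression_sequence M' X' a' b' A' B' C' \<and>
           correlation M' (X' 0) (X' 1) = \<rho> \<and> regression_ratio M' X' B' = R \<longrightarrow>
           distr M' borel (X' 0) = distr M borel (X 0)) \<and>
        distr M borel (\<lambda>\<omega>. - X 0 \<omega>) = distr M borel (X 0) \<and>
        (\<exists>l u. AE \<omega> in M. X 0 \<omega> \<in> {l..u}) \<and>
        (R = 0 \<longrightarrow>
           (\<exists>c>0. (AE \<omega> in M. X 0 \<omega> = c \<or> X 0 \<omega> = - c) \<and>
              measure M {\<omega> \<in> space M. X 0 \<omega> = c} > 0 \<and>
              measure M {\<omega> \<in> space M. X 0 \<omega> = - c} > 0))) \<and>
     (R = 2 \<longrightarrow> (\<exists>m s. s > 0 \<and> distributed M lborel (X 0) (normal_density m s))) \<and>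
     (R > 2 \<longrightarrow> moment_indeterminate (distr M borel (X 0)))"
proof (cases "0 \<le> R")
  case False
  then show ?thesis by simp
next
  case True
  interpret Q: quadratic_regression_sequence M X a b A B C by fact
  interpret nonneg_quadratic_regression M X a b A B C
    using Q.nonneg_quadratic_regressionI True assms(3) by simp
  note q_cases = q_cases[folded assms(3)]
  have unique: "distr M' borel (X' 0) = distr M borel (X 0)"
    if "R < 2" "quadratic_regression_sequence M' X' a' b' A' B' C'"
      "correlation M' (X' 0) (X' 1) = \<rho>" "regression_ratio M' X' B' = R"
    for M' :: "'b measure" and X' a' b' A' B' C'
  proof -
    interpret Q': quadratic_regression_sequence M' X' a' b' A' B' C' by fact
    interpret N: nonneg_quadratic_regression M' X' a' b' A' B' C'
      using Q'.nonneg_quadratic_regressionI True that by simp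
    have "N.q = q"
      using that unfolding N.q_eq(2) q_eq(2) by (simp add: Q'.\<rho>_def Q.\<rho>_def assms(2,3))
    then show ?thesis
      using q_cases(1)[OF that(1)] N.law_moments by (intro law_eqI N.real_distribution_law) auto
  qed
  have "\<exists>c>0. (AE \<omega> in M. X 0 \<omega> = c \<or> X 0 \<omega> = - c) \<and>
      measure M {\<omega> \<in> space M. X 0 \<omega> = c} > 0 \<and> measure M {\<omega> \<in> space M. X 0 \<omega> = - c} > 0" if "R = 0"
    using law_two_points[OF q_cases(2)[OF that]] by (intro exI[of _ 1]) simp
  moreover have "\<exists>m s. s > 0 \<and> distributed M lborel (X 0) (normal_density m s)" if "R = 2"
    using law_normal[OF q_cases(3)[OF that]] by (intro exI[of _ 0] exI[of _ 1]) simp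
  ultimately show ?thesis
    using unique law_symmetric law_bounded law_indeterminate q_cases(1,4) by blast
qed

end
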